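(* Let $0<q<1$, $\alpha\in\mathbb{R}$ with $|\alpha|>1$, $\lambda>0$, $j\in\mathbb{N}$, and let $\{\mathbb{H}_n(x;q)\}_{n\ge0}$ be the $q$-Hermite I-Sobolev type polynomials. Let $n\ge1$ be an integer. Set $$\vartheta_n(x)=-\frac{q^{n-2}[n]_q\,\mathcal{E}_{1,n}(x)}{\mathcal{F}_{1,n}(x)}-[n-1]_q,\qquad \psi_n(x)=\big((1-q)\vartheta_n(x)+1\big)^{-1}.$$ Then $$\mathbb{H}_n(x;q)=-\frac{\mathcal{F}_{1,n}(x)\,\big(1-\psi_n(x)q^{-1}\big)\,q^{\binom n2-n+2}}{[n]_q\,\psi_n(x)\,(1-q)}\;{}_3\phi_2\!\left(\begin{array}{c}q^{-n},\,x^{-1},\,\psi_n(x)\\ 0,\ \psi_n(x)q^{-1}\end{array};q,-qx\right)$$ for every real $x$ at which all quantities on the right-hand side are defined, i.e. $x\neq0$, $x\ne q^i\alpha$ for $0\le i\le j$, $\mathcal{F}_{1,n}(x)\ne0$, $(1-q)\vartheta_n(x)+1\neq0$, and $\psi_n(x)\ne q^{1-i}$ for $0\le i\le n-1$.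
   Context: Here $\mathbb{N}=\{0,1,2,\dots\}$ and $0<q<1$. Notation: $[n]_q=\frac{1-q^n}{1-q}$, $[0]_q!=1$, $[n]_q!=[n]_q\cdots[1]_q$; $(a;q)_n=\prod_{i=0}^{n-1}(1-aq^i)$ (also for $n=\infty$), $(a_1,\dots,a_r;q)_n=\prod_i(a_i;q)_n$; $[n]_q^{(k)}=\frac{(q^{-n};q)_k}{(q-1)^k}q^{kn-\binom{k}{2}}$ (equal to $[n]_q[n-1]_q\cdots[n-k+1]_q$). Basic hypergeometric series: ${}_3\phi_2\!\left(\begin{array}{c}a_1,a_2,a_3\\ b_1,b_2\end{array};q,z\right)=\sum_{k\ge0}\frac{(a_1,a_2,a_3;q)_k}{(b_1,b_2;q)_k}\frac{z^k}{(q;q)_k}$, which terminates at $k=n$ when $a_1=q^{-n}$. The $q$-derivative is $D_qf(x)=\frac{f(qx)-f(x)}{(q-1)x}$ for $x\ne0$ (and $f'(0)$ at $x=0$), $D_q^0f=f$, $D_q^k=D_q D_q^{k-1}$. The $q$-subtraction power is $(x\boxminus_q y)^m=\sum_{k=0}^m\frac{[m]_q!}{[k]_q![m-k]_q!}q^{\binom{k}{2}}(-y)^kx^{m-k}$ (equal to $\prod_{i=0}^{m-1}(x-q^iy)$). Monic $q$-Hermite I polynomials: $H_n(x;q)=q^{\binom n2}\sum_{k=0}^n\frac{(q^{-n};q)_k(x^{-1};q)_k}{(q;q)_k}(-qx)^k$ for $n\ge0$, and $H_m=0$ for $m<0$; equivalently $H_0=1$, $xH_n=H_{n+1}+\gamma_nH_{n-1}$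 with $\gamma_n=q^{n-1}(1-q^n)$. Put $\|H_n\|^2=(1-q)(q;q)_n(q,-1,-q;q)_\infty q^{\binom n2}$ and $K_{n,q}^{(i,l)}(x,y)=\sum_{k=0}^n\frac{(D_q^iH_k)(x;q)\,(D_q^lH_k)(y;q)}{\|H_k\|^2}$. Sobolev inner product (on real polynomials): $\langle f,g\rangle_\lambda=\int_{-1}^1f(x)g(x)(qx,-qx;q)_\infty d_qx+\lambda (D_q^jf)(\alpha)(D_q^jg)(\alpha)$, where $\int_{-1}^1h(t)d_qt=(1-q)\sum_{m\ge0}q^m\big(h(q^m)+h(-q^m)\big)$. $\mathbb{H}_n(x;q)$ is the monic polynomial of degree $n$, $\{\mathbb{H}_n\}$ being orthogonal with respect to $\langle\cdot,\cdot\rangle_\lambda$. Put, for $n\ge1$, $\mathcal{A}_n^{(j)}(x,y)=\frac{[j]_q!}{\|H_{n-1}\|^2(x\boxminus_qy)^{j+1}}\sum_{k=0}^j\frac{(D_q^kH_{n-1})(y;q)}{[k]_q!}(x\boxminus_qy)^k$, $\mathcal{B}_n^{(j)}(x,y)=-\frac{[j]_q!}{\|H_{n-1}\|^2(x\boxminus_qy)^{j+1}}\sum_{k=0}^j\frac{(D_q^kH_{n})(y;q)}{[k]_q!}(x\boxminus_qy)^k$, and, with $c_n=\lambda\frac{[n]_q^{(j)}H_{n-j}(\alpha;q)}{1+\lambda K_{n-1,q}^{(j,j)}(\alpha,\alpha)}$, $\mathcal{E}_{1,n}(x)=1-c_n\mathcal{A}_n^{(j)}(x,\alpha)$, $\mathcal{F}_{1,n}(x)=-c_n\mathcal{B}_n^{(j)}(x,\alpha)$.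 *)

theory Defs
  imports "HOL-Analysis.Analysis" "HOL-Computational_Algebra.Polynomial"
begin

definition qnum :: "real \<Rightarrow> nat \<Rightarrow> real" where
  "qnum q n = (1 - q ^ n) / (1 - q)"

definition qfact :: "real \<Rightarrow> nat \<Rightarrow> real" where
  "qfact q n = (\<Prod>i=1..n. qnum q i)"

definition qpoch :: "real \<Rightarrow> real \<Rightarrow> nat \<Rightarrow> real" where
  "qpoch a q n = (\<Prod>i<n. 1 - a * q ^ i)"

definition qpoch_inf :: "real \<Rightarrow> real \<Rightarrow> real" where
  "qpoch_inf a q = (\<Prod>i. 1 - a * q ^ i)"

text \<open>The \<open>q\<close>-falling factorial \<open>[n]\<^sub>q [n-1]\<^sub>q \<dots> [n-k+1]\<^sub>q\<close>; the exponent
  \<open>k n - binom k 2\<close> can be negative, hence integer powers.\<close>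

definition qfalling :: "real \<Rightarrow> nat \<Rightarrow> nat \<Rightarrow> real" where
  "qfalling q n k =
     qpoch (q powi (- int n)) q k / (q - 1) ^ k * q powi (int (k * n) - int (k choose 2))"

text \<open>In the uses below the first upper parameter is \<open>q\<^sup>-\<^sup>n\<close>, so all terms with \<open>k > n\<close> are
  zero (also those whose denominator vanishes, as \<open>0 / 0 = 0\<close>).\<close>

definition phi32 :: "real \<Rightarrow> real \<Rightarrow> real \<Rightarrow> real \<Rightarrow> real \<Rightarrow> real \<Rightarrow> real \<Rightarrow> real" where
  "phi32 a1 a2 a3 b1 b2 q z =
     (\<Sum>k. (qpoch a1 q k * qpoch a2 q k * qpoch a3 q k) / (qpoch b1 q k * qpoch b2 q k)
           * (z ^ k / qpoch q q k))"

definition qderiv :: "real \<Rightarrow> (real \<Rightarrow> real) \<Rightarrow> real \<Rightarrow> real" where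
  "qderiv q f x = (if x = 0 then deriv f 0 else (f (q * x) - f x) / ((q - 1) * x))"

definition qminus_power :: "real \<Rightarrow> real \<Rightarrow> real \<Rightarrow> nat \<Rightarrow> real" where
  "qminus_power q x y m =
     (\<Sum>k\<le>m. qfact q m / (qfact q k * qfact q (m - k))
            * q ^ (k choose 2) * (- y) ^ k * x ^ (m - k))"

text \<open>The Jackson \<open>q\<close>-integral over \<open>[-1, 1]\<close>.\<close>

definition qintegral :: "real \<Rightarrow> (real \<Rightarrow> real) \<Rightarrow> real" where
  "qintegral q h = (1 - q) * (\<Sum>m. q ^ m * (h (q ^ m) + h (- (q ^ m))))"

text \<open>The monic \<open>q\<close>-Hermite I polynomials. The factor \<open>(x\<^sup>-\<^sup>1; q)\<^sub>k x\<^sup>k\<close> of the defining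
  hypergeometric sum is the polynomial \<open>\<Prod>i<k. x - q\<^sup>i\<close>; writing it this way also gives the
  right value at \<open>x = 0\<close>.\<close>

definition qHermite :: "real \<Rightarrow> nat \<Rightarrow> real poly" where
  "qHermite q n =
     smult (q ^ (n choose 2))
       (\<Sum>k\<le>n. smult (qpoch (q powi (- int n)) q k / qpoch q q k * (- q) ^ k)
                  (\<Prod>i<k. [:- (q ^ i), 1:]))"

lemma poly_qHermite:
  assumes "x \<noteq> 0"
  shows "poly (qHermite q n) x =
    q ^ (n choose 2) *
    (\<Sum>k\<le>n. qpoch (q powi (- int n)) q k * qpoch (inverse x) q k / qpoch q q k
            * (- q * x) ^ k)"
proof -
  have "(\<Prod>i<k. x - q ^ i) = qpoch (inverse x) q k * x ^ k" for k
    unfolding qpoch_def using assms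
    by (induction k) (auto simp: field_simps)
  then show ?thesis
    by (simp add: qHermite_def poly_sum poly_prod mult_ac power_mult_distrib[of "- q" x, simplified])
qed

text \<open>Extension by zero to negative indices.\<close>

definition qHermite_int :: "real \<Rightarrow> int \<Rightarrow> real poly" where
  "qHermite_int q m = (if m < 0 then 0 else qHermite q (nat m))"

definition qHermite_norm2 :: "real \<Rightarrow> nat \<Rightarrow> real" where
  "qHermite_norm2 q n =
     (1 - q) * qpoch q q n * (qpoch_inf q q * qpoch_inf (- 1) q * qpoch_inf (- q) q)
       * q ^ (n choose 2)"

definition DqH :: "real \<Rightarrow> nat \<Rightarrow> nat \<Rightarrow> real \<Rightarrow> real" where
  "DqH q k n = (qderiv q ^^ k) (poly (qHermite q n))"

definition qkernel :: "real \<Rightarrow> nat \<Rightarrow> nat \<Rightarrow> nat \<Rightarrow> real \<Rightarrow> real \<Rightarrow> real" where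
  "qkernel q n i l x y = (\<Sum>k\<le>n. DqH q i k x * DqH q l k y / qHermite_norm2 q k)"

definition sobolev_ip ::
  "real \<Rightarrow> real \<Rightarrow> nat \<Rightarrow> real \<Rightarrow> real poly \<Rightarrow> real poly \<Rightarrow> real" where
  "sobolev_ip q lam j \<alpha> f g =
     qintegral q (\<lambda>x. poly f x * poly g x * (qpoch_inf (q * x) q * qpoch_inf (- (q * x)) q))
     + lam * (qderiv q ^^ j) (poly f) \<alpha> * (qderiv q ^^ j) (poly g) \<alpha>"

definition is_sobolev_monic_ops ::
  "real \<Rightarrow> real \<Rightarrow> nat \<Rightarrow> real \<Rightarrow> (nat \<Rightarrow> real poly) \<Rightarrow> bool" where
  "is_sobolev_monic_ops q lam j \<alpha> P \<longleftrightarrow>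
     (\<forall>n. degree (P n) = n \<and> lead_coeff (P n) = 1) \<and>
     (\<forall>m n. m \<noteq> n \<longrightarrow> sobolev_ip q lam j \<alpha> (P m) (P n) = 0)"

text \<open>The functions below are used for \<open>n \<ge> 1\<close> only, so that \<open>n - 1\<close> on \<open>nat\<close> is the
  ordinary difference.\<close>

definition A_fun :: "real \<Rightarrow> nat \<Rightarrow> nat \<Rightarrow> real \<Rightarrow> real \<Rightarrow> real" where
  "A_fun q j n x y =
     qfact q j / (qHermite_norm2 q (n - 1) * qminus_power q x y (j + 1))
     * (\<Sum>k\<le>j. DqH q k (n - 1) y / qfact q k * qminus_power q x y k)"

definition B_fun :: "real \<Rightarrow> nat \<Rightarrow> nat \<Rightarrow> real \<Rightarrow> real \<Rightarrow> real" where
  "B_fun q j n x y =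
     - (qfact q j / (qHermite_norm2 q (n - 1) * qminus_power q x y (j + 1)))
     * (\<Sum>k\<le>j. DqH q k n y / qfact q k * qminus_power q x y k)"

definition c_coeff :: "real \<Rightarrow> real \<Rightarrow> nat \<Rightarrow> real \<Rightarrow> nat \<Rightarrow> real" where
  "c_coeff q lam j \<alpha> n =
     lam * (qfalling q n j * poly (qHermite_int q (int n - int j)) \<alpha>
            / (1 + lam * qkernel q (n - 1) j j \<alpha> \<alpha>))"

definition E1 :: "real \<Rightarrow> real \<Rightarrow> nat \<Rightarrow> real \<Rightarrow> nat \<Rightarrow> real \<Rightarrow> real" where
  "E1 q lam j \<alpha> n x = 1 - c_coeff q lam j \<alpha> n * A_fun q j n x \<alpha>"

definition F1 :: "real \<Rightarrow> real \<Rightarrow> nat \<Rightarrow> real \<Rightarrow> nat \<Rightarrow> real \<Rightarrow> real" where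
  "F1 q lam j \<alpha> n x = - c_coeff q lam j \<alpha> n * B_fun q j n x \<alpha>"

definition vartheta :: "real \<Rightarrow> real \<Rightarrow> nat \<Rightarrow> real \<Rightarrow> nat \<Rightarrow> real \<Rightarrow> real" where
  "vartheta q lam j \<alpha> n x =
     - (q powi (int n - 2) * qnum q n * E1 q lam j \<alpha> n x / F1 q lam j \<alpha> n x) - qnum q (n - 1)"

definition psi :: "real \<Rightarrow> real \<Rightarrow> nat \<Rightarrow> real \<Rightarrow> nat \<Rightarrow> real \<Rightarrow> real" where
  "psi q lam j \<alpha> n x = inverse ((1 - q) * vartheta q lam j \<alpha> n x + 1)"

end

theory Submission
  imports Defs
begin

text \<open>
  Two facts combine. The first is a connection formula with rational coefficients,
  \<open>\<H>\<^sub>n = E\<^sub>1 H\<^sub>n + F\<^sub>1 H\<^sub>n\<^sub>-\<^sub>1\<close> (\<open>sobolev_connection_formula\<close>). The Sobolev product differs from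
  the \<open>q\<close>-Hermite one by a term of rank one, so orthogonality forces \<open>\<H>\<^sub>n - H\<^sub>n\<close> to be a multiple of
  the kernel \<open>K\<^sub>n\<^sub>-\<^sub>1(x,\<alpha>)\<close>, \<open>q\<close>-differentiated \<open>j\<close> times in the second variable
  (\<open>sobolev_monic_ops_expansion\<close>). The Christoffel-Darboux formula \<open>christoffel_darboux\<close> writes the
  kernel as a quotient with denominator \<open>x - y\<close>, and the rule \<open>qderiv_poly_linear_quotient\<close> for
  the \<open>q\<close>-derivatives of such a quotient turns it into a combination of \<open>H\<^sub>n\<close> and \<open>H\<^sub>n\<^sub>-\<^sub>1\<close>.

  The second fact is about the hypergeometric sum. The extra parameter pair \<open>\<psi>\<close>, \<open>\<psi>/q\<close>
  multiplies the \<open>k\<close>-th term of the expansion of \<open>H\<^sub>n\<close> by a linear function of \<open>q\<^sup>k\<close>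
  (\<open>phi32_eq\<close>). Constants reproduce \<open>H\<^sub>n\<close>, and \<open>q\<^sup>n\<^sup>-\<^sup>1 - q\<^sup>k\<^sup>-\<^sup>1\<close> lowers the degree by one
  (\<open>qHermite_coeff_lower\<close>). So every such sum is a combination of \<open>H\<^sub>n\<close> and \<open>H\<^sub>n\<^sub>-\<^sub>1\<close>, and
  \<open>\<psi>\<close> is the value for which the ratio of the two coefficients is \<open>E\<^sub>1 / F\<^sub>1\<close>.

  The orthogonality of the \<open>H\<^sub>n\<close> with the stated norms is needed with its exact constants, because the norms
  enter \<open>c\<^sub>n\<close> together with \<open>\<lambda>\<close>. It rests on two properties of the functional \<open>L\<close> given by the
  Jackson integral: the summation by parts \<open>L(x p) = (1 - q) L(D\<^sub>q p)\<close>, a telescoping sum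
  (\<open>jackson_functional_pCons_0\<close>), and the value \<open>L(1)\<close>, which is Euler's series \<open>euler_series\<close>.
  Orthogonality and norms then follow from the three-term recurrence \<open>qHermite_Suc_Suc\<close>.
\<close>

section \<open>\<open>q\<close>-numbers and \<open>q\<close>-shifted factorials\<close>

lemma choose_2_Suc: "Suc n choose 2 = (n choose 2) + n"
  by (simp add: numeral_2_eq_2)

lemma qnum_0 [simp]: "qnum q 0 = 0"
  by (simp add: qnum_def)

lemma qfact_0 [simp]: "qfact q 0 = 1"
  by (simp add: qfact_def)

lemma qfact_Suc [simp]: "qfact q (Suc n) = qnum q (Suc n) * qfact q n"
  by (simp add: qfact_def)

lemma qpoch_0 [simp]: "qpoch a q 0 = 1"
  by (simp add: qpoch_def)

lemma qpoch_Suc: "qpoch a q (Suc k) = qpoch a q k * (1 - a * q ^ k)"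
  by (simp add: qpoch_def)

lemma qpoch_Suc_shift: "qpoch a q (Suc k) = (1 - a) * qpoch (a * q) q k"
  unfolding qpoch_def by (subst prod.lessThan_Suc_shift) (simp add: mult_ac)

context
  fixes q :: real
  assumes q: "0 < q" "q < 1"
begin

lemma qnum_Suc: "qnum q (Suc n) = 1 + q * qnum q n"
  using q by (simp add: qnum_def field_simps)

lemma qnum_Suc': "qnum q (Suc n) = q ^ n + qnum q n"
  using q by (simp add: qnum_def field_simps)

lemma one_minus_q_power_pos: "n > 0 \<Longrightarrow> 1 - q ^ n > 0"
  using q by (simp add: power_less_one_iff)

lemma qnum_pos: "n > 0 \<Longrightarrow> qnum q n > 0"
  using one_minus_q_power_pos[of n] q by (simp add: qnum_def)

lemma qfact_pos: "qfact q n > 0"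
  by (induction n) (auto intro!: mult_pos_pos qnum_pos simp: qfact_Suc)

lemma qpoch_q_pos: "qpoch q q n > 0"
proof (induction n)
  case (Suc n)
  then show ?case
    using one_minus_q_power_pos[of "Suc n"] by (simp add: qpoch_Suc)
qed simp

end

section \<open>The \<open>q\<close>-derivative of polynomials\<close>

text \<open>The operator sends \<open>x\<^sup>n\<close> to \<open>[n]\<^sub>q x\<^sup>n\<^sup>-\<^sup>1\<close>. Keeping the iterates inside the type of polynomials
  makes linearity, the product rule and comparison of coefficients available, and removes the
  special role of the point \<open>0\<close>.\<close>

definition qderiv_poly :: "real \<Rightarrow> real poly \<Rightarrow> real poly" where
  "qderiv_poly q p = Abs_poly (\<lambda>n. qnum q (Suc n) * coeff p (Suc n))"

lemma coeff_qderiv_poly: "coeff (qderiv_poly q p) n = qnum q (Suc n) * coeff p (Suc n)"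
proof -
  have "\<forall>\<^sub>\<infinity>n. coeff p (Suc n) = 0"
    by (rule MOST_SucI[OF MOST_coeff_eq_0])
  then have "\<forall>\<^sub>\<infinity>n. qnum q (Suc n) * coeff p (Suc n) = 0"
    by (rule eventually_mono) simp
  then show ?thesis
    unfolding qderiv_poly_def by (subst Abs_poly_inverse) auto
qed

lemma qderiv_poly_add [simp]: "qderiv_poly q (p + r) = qderiv_poly q p + qderiv_poly q r"
  by (rule poly_eqI) (simp add: coeff_qderiv_poly algebra_simps)

lemma qderiv_poly_smult [simp]: "qderiv_poly q (smult c p) = smult c (qderiv_poly q p)"
  by (rule poly_eqI) (simp add: coeff_qderiv_poly algebra_simps)

lemma qderiv_poly_0 [simp]: "qderiv_poly q 0 = 0"
  by (rule poly_eqI) (simp add: coeff_qderiv_poly)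

lemma qderiv_poly_diff [simp]: "qderiv_poly q (p - r) = qderiv_poly q p - qderiv_poly q r"
  by (rule poly_eqI) (simp add: coeff_qderiv_poly algebra_simps)

lemma qderiv_poly_sum [simp]: "qderiv_poly q (\<Sum>i\<in>A. p i) = (\<Sum>i\<in>A. qderiv_poly q (p i))"
  by (rule poly_eqI) (simp add: coeff_qderiv_poly coeff_sum sum_distrib_left)

lemma funpow_qderiv_poly_diff [simp]:
  "(qderiv_poly q ^^ k) (p - r) = (qderiv_poly q ^^ k) p - (qderiv_poly q ^^ k) r"
  by (induction k) auto

lemma funpow_qderiv_poly_smult [simp]:
  "(qderiv_poly q ^^ k) (smult c p) = smult c ((qderiv_poly q ^^ k) p)"
  by (induction k) auto

lemma funpow_qderiv_poly_0 [simp]: "(qderiv_poly q ^^ k) 0 = 0"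
  by (induction k) auto

lemma funpow_qderiv_poly_sum [simp]:
  "(qderiv_poly q ^^ k) (\<Sum>i\<in>A. p i) = (\<Sum>i\<in>A. (qderiv_poly q ^^ k) (p i))"
  by (induction k) auto

lemma qderiv_poly_1 [simp]: "qderiv_poly q 1 = 0"
  by (rule poly_eqI) (simp add: coeff_qderiv_poly)

context
  fixes q :: real
  assumes q: "0 < q" "q < 1"
begin

lemma qderiv_poly_pCons:
  "qderiv_poly q (pCons a p) = p + smult q (pCons 0 (qderiv_poly q p))"
proof (rule poly_eqI)
  fix n
  show "coeff (qderiv_poly q (pCons a p)) n = coeff (p + smult q (pCons 0 (qderiv_poly q p))) n"
    using qnum_Suc[OF q, of n] by (cases n) (simp_all add: coeff_qderiv_poly algebra_simps)
qed

text \<open>Horner induction turns the coefficient description into the difference quotient.\<close>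

lemma poly_qderiv_poly_times:
  "(q - 1) * x * poly (qderiv_poly q p) x = poly p (q * x) - poly p x"
proof (induction p)
  case (pCons a p)
  have "(q - 1) * x * poly (qderiv_poly q (pCons a p)) x =
     (q - 1) * x * poly p x + q * x * ((q - 1) * x * poly (qderiv_poly q p) x)"
    by (simp add: qderiv_poly_pCons algebra_simps)
  also have "\<dots> = poly (pCons a p) (q * x) - poly (pCons a p) x"
    unfolding pCons.IH by (simp add: algebra_simps)
  finally show ?case .
qed simp

lemma qderiv_poly_eq: "qderiv q (poly p) = poly (qderiv_poly q p)"
proof
  fix x
  show "qderiv q (poly p) x = poly (qderiv_poly q p) x"
  proof (cases "x = 0")
    case True
    have "deriv (poly p) 0 = poly (pderiv p) 0"
      by (rule DERIV_imp_deriv[OF poly_DERIV])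
    also have "\<dots> = poly (qderiv_poly q p) 0"
      using qnum_Suc[OF q, of 0] by (simp add: poly_0_coeff_0 coeff_pderiv coeff_qderiv_poly)
    finally show ?thesis
      using True by (simp add: qderiv_def)
  next
    case False
    then show ?thesis
      using poly_qderiv_poly_times[of x p] q by (simp add: qderiv_def field_simps)
  qed
qed

lemma funpow_qderiv_poly_eq: "(qderiv q ^^ k) (poly p) = poly ((qderiv_poly q ^^ k) p)"
  by (induction k) (simp_all add: qderiv_poly_eq)

text \<open>The \<open>q\<close>-Leibniz rule for the factor \<open>x\<close>: all of its derivatives from the second one on vanish, so only
  two terms survive.\<close>

lemma funpow_qderiv_poly_pCons_0:
  "(qderiv_poly q ^^ Suc k) (pCons 0 p) =
     smult (q ^ Suc k) (pCons 0 ((qderiv_poly q ^^ Suc k) p))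
     + smult (qnum q (Suc k)) ((qderiv_poly q ^^ k) p)"
proof (induction k)
  case 0
  show ?case
    using qnum_Suc[OF q, of 0] by (simp add: qderiv_poly_pCons)
next
  case (Suc k)
  have "(qderiv_poly q ^^ Suc (Suc k)) (pCons 0 p) =
     smult (q ^ Suc k) ((qderiv_poly q ^^ Suc k) p
        + smult q (pCons 0 ((qderiv_poly q ^^ Suc (Suc k)) p)))
     + smult (qnum q (Suc k)) ((qderiv_poly q ^^ Suc k) p)"
    unfolding funpow.simps(2)[of "Suc k"] o_apply Suc.IH
    by (simp add: qderiv_poly_pCons del: smult_pCons)
  then show ?case
    by (simp add: qnum_Suc'[OF q, of "Suc k"] smult_add_left smult_add_right mult.commute
        del: smult_pCons funpow.simps)
qed

text \<open>No \<open>[n]\<^sub>q\<close> with \<open>n > 0\<close> vanishes, so the \<open>q\<close>-derivative determines every coefficient but the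
  constant one, and one value fixes that.\<close>

lemma qderiv_poly_eqI:
  assumes "qderiv_poly q p = qderiv_poly q r" "poly p a = poly r a"
  shows "p = r"
proof -
  have "coeff (p - r) (Suc n) = 0" for n
    using arg_cong[OF assms(1), of "\<lambda>p. coeff p n"] qnum_pos[OF q, of "Suc n"]
    by (simp add: coeff_qderiv_poly)
  then have "p - r = [:coeff (p - r) 0:]"
    by (intro poly_eqI) (simp add: coeff_pCons split: nat.split)
  moreover have "poly (p - r) a = 0"
    using assms by simp
  ultimately have "p - r = 0"
    by (metis mult_zero_right poly_pCons poly_0 add.right_neutral pCons_0_0)
  then show ?thesis by simp
qed

text \<open>The finite \<open>q\<close>-binomial theorem, by the \<open>q\<close>-Pascal rule.\<close>

lemma qminus_power_eq_prod: "qminus_power q x y m = (\<Prod>i<m. x - q ^ i * y)"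
proof (induction m)
  case 0
  show ?case by (simp add: qminus_power_def numeral_2_eq_2)
next
  case (Suc m)
  \<comment> \<open>\<open>q\<close>-binomial coefficients; without the zero above the diagonal, the quotient would be nonzero at
      \<open>k = m + 1\<close> because of the truncated subtraction\<close>
  define b where "b m k = (if k \<le> m then qfact q m / (qfact q k * qfact q (m - k)) else 0)"
    for m k :: nat
  define t where "t k = q ^ (k choose 2) * (- y) ^ k" for k :: nat
  have fact_nz: "qfact q k \<noteq> 0" for k
    using qfact_pos[OF q, of k] by simp
  have b_0: "b m 0 = 1" for m
    using fact_nz[of m] by (simp add: b_def)
  have pascal: "b (Suc m) (Suc k) = b m (Suc k) + q ^ (m - k) * b m k" if "k \<le> m" for k
  proof (cases "k = m")
    case True
    then show ?thesis
      using fact_nz[of "Suc k"] fact_nz[of k] by (simp add: b_def del: qfact_Suc)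
  next
    case False
    with that have "k < m"
      by simp
    then obtain d where d: "m = Suc (k + d)"
      by (auto dest: less_imp_Suc_add)
    have nz: "qnum q (Suc k) \<noteq> 0" "qnum q (Suc d) \<noteq> 0"
      using qnum_pos[OF q, of "Suc k"] qnum_pos[OF q, of "Suc d"] by auto
    have "qnum q (Suc (Suc (k + d))) = qnum q (Suc d) + q ^ Suc d * qnum q (Suc k)"
      using q by (simp add: qnum_def field_simps power_add)
    moreover have "k \<le> m" "Suc k \<le> m" "m - k = Suc d" "m - Suc k = d" "Suc m - Suc k = Suc d"
      using d by auto
    ultimately show ?thesis
      using fact_nz[of k] fact_nz[of d] nz
      by (simp add: b_def d divide_simps del: power_Suc) (simp add: algebra_simps)
  qed
  have sum_b: "qminus_power q x y m = (\<Sum>k\<le>m. b m k * t k * x ^ (m - k))" for m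
    unfolding qminus_power_def by (rule sum.cong) (auto simp: b_def t_def)
  have t_0: "t 0 = 1"
    by (simp add: t_def numeral_2_eq_2)
  have t_Suc: "t (Suc k) = - (q ^ k * y * t k)" for k
    by (simp add: t_def numeral_2_eq_2 power_add)
  have "qminus_power q x y (Suc m) =
      x ^ Suc m + (\<Sum>k\<le>m. (b m (Suc k) + q ^ (m - k) * b m k) * t (Suc k) * x ^ (m - k))"
    unfolding sum_b by (subst sum.atMost_Suc_shift) (simp add: b_0 pascal t_0)
  also have "\<dots> = (x ^ Suc m + (\<Sum>k\<le>m. b m (Suc k) * t (Suc k) * x ^ (Suc m - Suc k)))
      + (\<Sum>k\<le>m. q ^ (m - k) * b m k * t (Suc k) * x ^ (m - k))"
    by (simp add: algebra_simps sum.distrib)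
  also have "x ^ Suc m + (\<Sum>k\<le>m. b m (Suc k) * t (Suc k) * x ^ (Suc m - Suc k)) =
      (\<Sum>k\<le>Suc m. b m k * t k * x ^ (Suc m - k))"
    by (subst sum.atMost_Suc_shift) (simp add: b_0 t_0)
  also have "\<dots> = x * (\<Sum>k\<le>m. b m k * t k * x ^ (m - k))"
    by (simp add: b_def[of m "Suc m"] sum_distrib_left)
       (rule sum.cong, simp_all add: Suc_diff_le)
  also have "(\<Sum>k\<le>m. q ^ (m - k) * b m k * t (Suc k) * x ^ (m - k)) =
      - (q ^ m * y) * (\<Sum>k\<le>m. b m k * t k * x ^ (m - k))"
    unfolding sum_distrib_left
  proof (rule sum.cong[OF refl])
    fix k assume "k \<in> {..m}"
    then have "q ^ m = q ^ (m - k) * q ^ k"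
      by (simp flip: power_add)
    then show "q ^ (m - k) * b m k * t (Suc k) * x ^ (m - k) =
        - (q ^ m * y) * (b m k * t k * x ^ (m - k))"
      by (simp add: t_Suc)
  qed
  finally have "qminus_power q x y (Suc m) = (x - q ^ m * y) * qminus_power q x y m"
    unfolding sum_b[of m] by (simp add: algebra_simps)
  then show ?case
    using Suc.IH by simp
qed

text \<open>The \<open>q\<close>-derivatives of the quotient \<open>f(y) / (x - y)\<close>. Applying the Leibniz rule to
  \<open>(x - y) F(y) = f(y)\<close> gives \<open>(x - q\<^sup>j y) D\<^sup>j F(y) = D\<^sup>j f(y) + [j]\<^sub>q D\<^sup>j\<^sup>-\<^sup>1 F(y)\<close>; unrolling this recursion in
  \<open>j\<close> produces exactly the sum that occurs in the coefficients \<open>\<A>\<close> and \<open>\<B>\<close>. Stating it for a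
  polynomial \<open>F\<close> avoids \<open>q\<close>-derivatives of rational functions.\<close>

lemma qderiv_poly_linear_quotient:
  assumes f: "[:x, -1:] * F = f" and nz: "\<And>i. i \<le> j \<Longrightarrow> x \<noteq> q ^ i * y"
  shows "poly ((qderiv_poly q ^^ j) F) y =
    qfact q j / qminus_power q x y (j + 1)
      * (\<Sum>k\<le>j. poly ((qderiv_poly q ^^ k) f) y / qfact q k * qminus_power q x y k)"
  using nz
proof (induction j)
  case 0
  have "(x - y) * poly F y = poly f y"
    using arg_cong[OF f, of "\<lambda>p. poly p y"] by (simp add: algebra_simps)
  then show ?case
    using 0[of 0] by (simp add: qminus_power_eq_prod field_simps)
next
  case (Suc j)
  define P where "P m = qminus_power q x y m" for m
  have P_Suc: "P (Suc m) = P m * (x - q ^ m * y)" for m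
    by (simp add: P_def qminus_power_eq_prod)
  have P_nz: "P m \<noteq> 0" if "m \<le> Suc (Suc j)" for m
    using Suc.prems that by (auto simp: P_def qminus_power_eq_prod)
  have f': "f = smult x F - pCons 0 F"
    unfolding f[symmetric] by simp
  have "poly ((qderiv_poly q ^^ Suc j) f) y =
      (x - q ^ Suc j * y) * poly ((qderiv_poly q ^^ Suc j) F) y
      - qnum q (Suc j) * poly ((qderiv_poly q ^^ j) F) y"
    unfolding f' funpow_qderiv_poly_diff funpow_qderiv_poly_pCons_0 funpow_qderiv_poly_smult
    by (simp add: algebra_simps)
  moreover have "x - q ^ Suc j * y \<noteq> 0"
    using Suc.prems[of "Suc j"] by simp
  ultimately have "poly ((qderiv_poly q ^^ Suc j) F) y =
      (poly ((qderiv_poly q ^^ Suc j) f) y + qnum q (Suc j) * poly ((qderiv_poly q ^^ j) F) y)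
      / (x - q ^ Suc j * y)"
    by (simp add: field_simps)
  also have "poly ((qderiv_poly q ^^ j) F) y =
    qfact q j / P (Suc j) * (\<Sum>k\<le>j. poly ((qderiv_poly q ^^ k) f) y / qfact q k * P k)"
    using Suc unfolding P_def by simp
  also have "(poly ((qderiv_poly q ^^ Suc j) f) y + qnum q (Suc j) *
        (qfact q j / P (Suc j) * (\<Sum>k\<le>j. poly ((qderiv_poly q ^^ k) f) y / qfact q k * P k)))
        / (x - q ^ Suc j * y) =
      qfact q (Suc j) / P (Suc (Suc j))
        * (\<Sum>k\<le>Suc j. poly ((qderiv_poly q ^^ k) f) y / qfact q k * P k)"
    using \<open>x - q ^ Suc j * y \<noteq> 0\<close> P_nz[of "Suc j"] qfact_pos[OF q, of "Suc j"] P_Suc[of "Suc j"]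
    by (simp add: divide_simps distrib_left del: power_Suc qfact_Suc funpow.simps)
       (simp add: algebra_simps del: power_Suc funpow.simps)
  finally show ?case
    by (simp add: P_def)
qed

end

section \<open>The \<open>q\<close>-Hermite I polynomials\<close>

text \<open>The power basis adapted to \<open>D\<^sub>q\<close> and to the expansion of \<open>H\<^sub>n\<close>: \<open>(x \<boxminus>\<^sub>q 1)\<^sup>k\<close>.\<close>

definition qroots_poly :: "real \<Rightarrow> nat \<Rightarrow> real poly" where
  "qroots_poly q k = (\<Prod>i<k. [:- (q ^ i), 1:])"

definition qHermite_coeff :: "real \<Rightarrow> nat \<Rightarrow> nat \<Rightarrow> real" where
  "qHermite_coeff q n k = qpoch (q powi (- int n)) q k / qpoch q q k * (- q) ^ k"

lemma smult_sum_right: "smult c (\<Sum>i\<in>A. p i) = (\<Sum>i\<in>A. smult c (p i))"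
  by (rule poly_eqI) (simp add: coeff_sum sum_distrib_left)

context
  fixes q :: real
  assumes q: "0 < q" "q < 1"
begin

lemma qroots_poly_Suc:
  "qroots_poly q (Suc k) = pCons 0 (qroots_poly q k) - smult (q ^ k) (qroots_poly q k)"
  by (simp add: qroots_poly_def algebra_simps smult_diff_left flip: minus_pCons)

lemma qroots_poly_0 [simp]: "qroots_poly q 0 = 1"
  by (simp add: qroots_poly_def)

lemma qderiv_poly_qroots_poly:
  "qderiv_poly q (qroots_poly q (Suc k)) = smult (qnum q (Suc k)) (qroots_poly q k)"
proof (induction k)
  case 0
  show ?case
    using q by (simp add: qroots_poly_Suc qderiv_poly_pCons qnum_Suc)
next
  case (Suc k)
  have "qderiv_poly q (qroots_poly q (Suc (Suc k))) =
      qroots_poly q (Suc k) + smult (q * qnum q (Suc k))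
        (pCons 0 (qroots_poly q k) - smult (q ^ k) (qroots_poly q k))"
    unfolding qroots_poly_Suc[of "Suc k"] qderiv_poly_diff qderiv_poly_pCons[OF q]
      qderiv_poly_smult Suc.IH
    by (simp add: smult_diff_right mult_ac del: smult_pCons)
       (simp add: mult_ac)
  also have "\<dots> = smult (qnum q (Suc (Suc k))) (qroots_poly q (Suc k))"
    unfolding qroots_poly_Suc[symmetric] by (simp add: qnum_Suc[OF q, of "Suc k"] smult_add_left)
  finally show ?case .
qed

lemma qpoch_inverse_power_Suc:
  "qpoch (q powi (- int (Suc n))) q (Suc k) =
     (1 - inverse (q ^ Suc n)) * qpoch (q powi (- int n)) q k"
proof -
  have "q powi (- int (Suc n)) = inverse (q ^ Suc n)"
    by (simp only: power_int_minus power_int_of_nat)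
  moreover have "inverse (q ^ Suc n) * q = q powi (- int n)"
    using q by (simp add: power_int_minus)
  ultimately show ?thesis
    by (simp only: qpoch_Suc_shift)
qed

lemma qHermite_altdef:
  "qHermite q n =
     smult (q ^ (n choose 2)) (\<Sum>k\<le>n. smult (qHermite_coeff q n k) (qroots_poly q k))"
  by (simp add: qHermite_def qHermite_coeff_def qroots_poly_def)

lemma qHermite_coeff_Suc_Suc:
  "qHermite_coeff q (Suc n) (Suc k) * qnum q (Suc k) * q ^ n = qnum q (Suc n) * qHermite_coeff q n k"
proof -
  have 1: "qpoch (q powi (- int (Suc n))) q (Suc k) =
      (1 - inverse (q ^ Suc n)) * qpoch (q powi (- int n)) q k"
    by (rule qpoch_inverse_power_Suc)
  have 2: "qpoch q q (Suc k) = qpoch q q k * (1 - q ^ Suc k)"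
    by (simp add: qpoch_Suc)
  have 3: "1 - q ^ Suc k \<noteq> 0" "qpoch q q k \<noteq> 0" "q \<noteq> 0" "1 - q \<noteq> 0"
    using one_minus_q_power_pos[OF q, of "Suc k"] qpoch_q_pos[OF q, of k] q by auto
  have 4: "(1 - inverse (q ^ Suc n)) * (- q) * q ^ n = 1 - q ^ Suc n"
    using 3 by (simp add: field_simps)
  have "qHermite_coeff q (Suc n) (Suc k) * qnum q (Suc k) * q ^ n =
     ((1 - inverse (q ^ Suc n)) * (- q) * q ^ n) * (qpoch (q powi (- int n)) q k * (- q) ^ k)
       / (qpoch q q k * (1 - q))"
    unfolding qHermite_coeff_def 1 2 qnum_def using 3
    by (simp add: divide_simps del: power_Suc) (simp add: algebra_simps)
  then show ?thesis
    unfolding 4 by (simp add: qHermite_coeff_def qnum_def del: power_Suc)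
qed

lemma qHermite_0 [simp]: "qHermite q 0 = 1"
  by (simp add: qHermite_altdef qHermite_coeff_def numeral_2_eq_2 qpoch_def)

text \<open>The factor \<open>[k]\<^sub>q\<close> produced by \<open>D\<^sub>q\<close> cancels the last factor of \<open>(q;q)\<^sub>k\<close>, and
  \<open>(q\<^sup>-\<^sup>n;q)\<^sub>k\<close> loses its first factor; what is left is the expansion of \<open>H\<close> one degree lower.\<close>

lemma qderiv_poly_qHermite:
  "qderiv_poly q (qHermite q (Suc n)) = smult (qnum q (Suc n)) (qHermite q n)"
proof -
  have "qderiv_poly q (qHermite q (Suc n)) =
     smult (q ^ (n choose 2)) (\<Sum>k\<le>n. smult
       (qHermite_coeff q (Suc n) (Suc k) * qnum q (Suc k) * q ^ n) (qroots_poly q k))"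
    unfolding qHermite_altdef qderiv_poly_smult qderiv_poly_sum
    by (subst sum.atMost_Suc_shift)
       (simp add: qderiv_poly_qroots_poly qderiv_poly_1 choose_2_Suc power_add
          smult_sum_right mult_ac)
  also have "\<dots> = smult (qnum q (Suc n)) (qHermite q n)"
    unfolding qHermite_coeff_Suc_Suc by (simp add: qHermite_altdef smult_sum_right mult_ac)
  finally show ?thesis .
qed

text \<open>At \<open>x = 1\<close> all basis elements but the constant one vanish.\<close>

lemma poly_qHermite_1: "poly (qHermite q n) 1 = q ^ (n choose 2)"
proof -
  have at_1: "poly (qroots_poly q k) 1 = (if k = 0 then 1 else 0)" for k
    unfolding qroots_poly_def by (induction k) auto
  have "poly (qHermite q n) 1 =
      q ^ (n choose 2) * (\<Sum>k\<le>n. if k = 0 then qHermite_coeff q n k else 0)"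
    by (simp add: qHermite_altdef poly_sum at_1 if_distrib cong: if_cong)
  then show ?thesis
    by (simp add: qHermite_coeff_def qpoch_def)
qed

lemma qHermite_1: "qHermite q (Suc 0) = [:0, 1:]"
  by (rule qderiv_poly_eqI[OF q, of _ _ 1])
     (use q in \<open>simp_all add: qderiv_poly_qHermite poly_qHermite_1 qderiv_poly_pCons[OF q]
        qnum_Suc numeral_2_eq_2 one_pCons\<close>)

text \<open>The three-term recurrence. By \<open>D\<^sub>q(x f) = f + q x D\<^sub>q f\<close>, the \<open>q\<close>-derivative of the recurrence
  at \<open>n + 1\<close> reduces to the recurrence at \<open>n\<close>; the remaining constant is checked at \<open>x = 1\<close>.\<close>

lemma qHermite_Suc_Suc:
  "qHermite q (Suc (Suc n)) =
     pCons 0 (qHermite q (Suc n)) - smult (q ^ n * (1 - q ^ Suc n)) (qHermite q n)"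
proof (induction n)
  case 0
  show ?case
  proof (rule qderiv_poly_eqI[OF q, of _ _ 1])
    show "qderiv_poly q (qHermite q (Suc (Suc 0))) =
      qderiv_poly q (pCons 0 (qHermite q (Suc 0)) - smult (q ^ 0 * (1 - q ^ Suc 0)) (qHermite q 0))"
      using q by (simp add: qderiv_poly_qHermite qHermite_1 qderiv_poly_pCons[OF q] qnum_Suc
          one_pCons)
    show "poly (qHermite q (Suc (Suc 0))) 1 =
      poly (pCons 0 (qHermite q (Suc 0)) - smult (q ^ 0 * (1 - q ^ Suc 0)) (qHermite q 0)) 1"
      using q by (simp add: poly_qHermite_1 choose_2_Suc numeral_2_eq_2)
  qed
next
  case (Suc n)
  show ?case
  proof (rule qderiv_poly_eqI[OF q, of _ _ 1])
    have x_H: "pCons 0 (qHermite q (Suc n)) =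
        qHermite q (Suc (Suc n)) + smult (q ^ n * (1 - q ^ Suc n)) (qHermite q n)"
      using Suc by simp
    have const: "q * qnum q (Suc (Suc n)) * (q ^ n * (1 - q ^ Suc n)) =
        q ^ Suc n * (1 - q ^ Suc (Suc n)) * qnum q (Suc n)"
      by (simp add: qnum_def)
    have "qderiv_poly q (pCons 0 (qHermite q (Suc (Suc n)))) =
        qHermite q (Suc (Suc n)) + smult (q * qnum q (Suc (Suc n))) (pCons 0 (qHermite q (Suc n)))"
      unfolding qderiv_poly_pCons[OF q] qderiv_poly_qHermite by simp
    also have "\<dots> = smult (1 + q * qnum q (Suc (Suc n))) (qHermite q (Suc (Suc n)))
        + smult (q ^ Suc n * (1 - q ^ Suc (Suc n)) * qnum q (Suc n)) (qHermite q n)"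
      unfolding x_H const[symmetric] by (simp add: smult_add_left smult_add_right del: power_Suc)
    finally show "qderiv_poly q (qHermite q (Suc (Suc (Suc n)))) =
      qderiv_poly q (pCons 0 (qHermite q (Suc (Suc n)))
        - smult (q ^ Suc n * (1 - q ^ Suc (Suc n))) (qHermite q (Suc n)))"
      by (simp add: qderiv_poly_qHermite qnum_Suc[OF q, of "Suc (Suc n)"] del: power_Suc)
    have "q ^ (Suc (Suc n) choose 2) = q ^ (Suc n choose 2) * q ^ Suc n"
      by (simp only: choose_2_Suc power_add)
    moreover have "q ^ (Suc (Suc (Suc n)) choose 2) =
        q ^ (Suc n choose 2) * q ^ Suc n * q ^ Suc (Suc n)"
      by (simp only: choose_2_Suc power_add)
    ultimately show "poly (qHermite q (Suc (Suc (Suc n)))) 1 =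
      poly (pCons 0 (qHermite q (Suc (Suc n)))
        - smult (q ^ Suc n * (1 - q ^ Suc (Suc n))) (qHermite q (Suc n))) 1"
      by (simp add: poly_qHermite_1 algebra_simps)
  qed
qed

lemma degree_le_qHermite: "degree (qHermite q n) \<le> n"
proof (induction n rule: induct_nat_012)
  case (ge2 n)
  have "degree (pCons 0 (qHermite q (Suc n))) \<le> Suc (Suc n)"
    using ge2 by (auto simp: degree_pCons_eq_if)
  moreover have "degree (smult (q ^ n * (1 - q ^ Suc n)) (qHermite q n)) \<le> Suc (Suc n)"
    using ge2 by (intro order.trans[OF degree_smult_le]) simp
  ultimately show ?case
    unfolding qHermite_Suc_Suc by (rule degree_diff_le)
qed (simp_all add: qHermite_1 q)

lemma coeff_qHermite_top: "coeff (qHermite q n) n = 1"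
proof (induction n rule: induct_nat_012)
  case (ge2 n)
  have "coeff (qHermite q n) (Suc (Suc n)) = 0"
    using degree_le_qHermite[of n] by (intro coeff_eq_0) simp
  then show ?case
    using ge2 by (simp add: qHermite_Suc_Suc)
qed (simp_all add: qHermite_1 q)

lemma DqH_eq: "DqH q k n y = poly ((qderiv_poly q ^^ k) (qHermite q n)) y"
  by (simp add: DqH_def funpow_qderiv_poly_eq[OF q])

lemma qfalling_0: "qfalling q n 0 = 1"
  by (simp add: qfalling_def qpoch_def numeral_2_eq_2)

text \<open>The negative powers of \<open>q\<close> in \<open>(q\<^sup>-\<^sup>n;q)\<^sub>k\<close> are compensated by \<open>q\<^sup>k\<^sup>n\<close>; peeling off the first factor shows
  the falling-factorial recursion.\<close>

lemma qfalling_Suc: "qfalling q (Suc n) (Suc k) = qnum q (Suc n) * qfalling q n k"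
proof -
  have shift: "qpoch (q powi (- int (Suc n))) q (Suc k) =
      (1 - inverse (q ^ Suc n)) * qpoch (q powi (- int n)) q k"
    by (rule qpoch_inverse_power_Suc)
  have exponent: "q powi (int (Suc k * Suc n) - int (Suc k choose 2)) =
      q ^ Suc n * q powi (int (k * n) - int (k choose 2))"
  proof -
    have "int (Suc k * Suc n) - int (Suc k choose 2) =
        int (Suc n) + (int (k * n) - int (k choose 2))"
      by (simp add: choose_2_Suc algebra_simps)
    moreover have "q powi (int (Suc n) + e) = q powi int (Suc n) * q powi e" for e
      by (rule power_int_add) (use q in simp)
    ultimately show ?thesis
      by (simp only: power_int_of_nat)
  qed
  have factor: "(1 - inverse (q ^ Suc n)) * q ^ Suc n / (q - 1) = qnum q (Suc n)"
    using q by (simp add: qnum_def field_simps)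
  show ?thesis
    unfolding qfalling_def shift exponent factor[symmetric] power_Suc[of "q - 1"]
    using q by (simp add: mult_ac del: power_Suc)
qed

lemma qfalling_eq_0: "qfalling q 0 (Suc k) = 0"
  by (simp add: qfalling_def qpoch_Suc_shift)

text \<open>This identifies the numerator of \<open>c\<^sub>n\<close>: it is \<open>D\<^sub>q\<^sup>j H\<^sub>n\<close> at \<open>\<alpha>\<close>, also for \<open>j > n\<close>, where
  both sides vanish.\<close>

lemma DqH_qfalling:
  "DqH q k n y = qfalling q n k * poly (qHermite_int q (int n - int k)) y"
proof (induction k arbitrary: n)
  case 0
  show ?case
    by (simp add: DqH_def qfalling_0 qHermite_int_def)
next
  case (Suc k)
  show ?case
  proof (cases n)
    case 0
    then show ?thesis
      by (simp add: DqH_eq qderiv_poly_1 qfalling_eq_0 funpow_swap1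
          del: funpow.simps add: funpow_Suc_right)
  next
    case (Suc m)
    have "DqH q (Suc k) n y = qnum q n * DqH q k m y"
      unfolding DqH_eq funpow_Suc_right o_apply Suc qderiv_poly_qHermite by simp
    then show ?thesis
      using Suc.IH[of m] Suc by (simp add: qfalling_Suc)
  qed
qed

end

section \<open>Infinite products and Euler's series\<close>

context
  fixes q :: real
  assumes q: "0 < q" "q < 1"
begin

lemma qpoch_inf_tendsto_nonzero:
  assumes "\<And>i. a * q ^ i \<noteq> 1"
  shows "qpoch a q \<longlonglongrightarrow> qpoch_inf a q" "qpoch_inf a q \<noteq> 0"
proof -
  have "summable (\<lambda>i. \<bar>a\<bar> * q ^ i)"
    using q by (intro summable_mult summable_geometric) simp
  then have "summable (\<lambda>i. \<bar>- (a * q ^ i)\<bar>)"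
    using q by (simp add: abs_mult)
  then have conv: "convergent_prod (\<lambda>i. 1 + - (a * q ^ i))"
    by (rule summable_imp_convergent_prod_real) (use assms in auto)
  have "(\<lambda>n. qpoch a q (Suc n)) \<longlonglongrightarrow> qpoch_inf a q"
    using convergent_prod_LIMSEQ[OF conv] by (simp add: qpoch_def qpoch_inf_def lessThan_Suc_atMost)
  then show "qpoch a q \<longlonglongrightarrow> qpoch_inf a q"
    by (rule LIMSEQ_imp_Suc)
  show "qpoch_inf a q \<noteq> 0"
    using prodinf_nonzero[OF conv] assms by (simp add: qpoch_inf_def)
qed

lemma qpoch_inf_shift:
  assumes "\<And>i. a * q ^ i \<noteq> 1"
  shows "qpoch_inf a q = (1 - a) * qpoch_inf (a * q) q"
proof -
  have "(a * q) * q ^ i \<noteq> 1" for i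
    using assms[of "Suc i"] by (simp add: mult_ac)
  then have "(\<lambda>n. (1 - a) * qpoch (a * q) q n) \<longlonglongrightarrow> (1 - a) * qpoch_inf (a * q) q"
    by (intro tendsto_intros qpoch_inf_tendsto_nonzero)
  moreover have "(\<lambda>n. (1 - a) * qpoch (a * q) q n) \<longlonglongrightarrow> qpoch_inf a q"
    using LIMSEQ_Suc[OF qpoch_inf_tendsto_nonzero(1)[OF assms]] by (simp add: qpoch_Suc_shift)
  ultimately show ?thesis
    using LIMSEQ_unique by blast
qed

lemma qpoch_factors_nonzero: "q ^ Suc m * q ^ i \<noteq> 1" "- (q ^ m) * q ^ i \<noteq> 1"
proof -
  have "q ^ Suc (m + i) < 1"
    using one_minus_q_power_pos[OF q, of "Suc (m + i)"] by simp
  then show "q ^ Suc m * q ^ i \<noteq> 1"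
    by (simp add: power_add mult.assoc)
  have "q ^ m * q ^ i > 0"
    using q by simp
  then show "- (q ^ m) * q ^ i \<noteq> 1"
    by linarith
qed

lemma qpoch_inf_lim: "qpoch (q ^ Suc m) q \<longlonglongrightarrow> qpoch_inf (q ^ Suc m) q"
    "qpoch (- (q ^ m)) q \<longlonglongrightarrow> qpoch_inf (- (q ^ m)) q"
  and qpoch_inf_nz: "qpoch_inf (q ^ Suc m) q \<noteq> 0" "qpoch_inf (- (q ^ m)) q \<noteq> 0"
  by (rule qpoch_inf_tendsto_nonzero; rule qpoch_factors_nonzero)+

lemma Bseq_inverse_qpoch: "Bseq (\<lambda>m. inverse (qpoch q q m))"
proof -
  have "(\<lambda>m. inverse (qpoch q q m)) \<longlonglongrightarrow> inverse (qpoch_inf q q)"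
    using qpoch_inf_lim(1)[of 0] qpoch_inf_nz(1)[of 0] by (intro tendsto_inverse) simp_all
  then show ?thesis
    by (rule convergent_imp_Bseq[OF convergentI])
qed

lemma summable_euler_series:
  assumes "\<bar>z\<bar> < 1"
  shows "summable (\<lambda>m. inverse (qpoch q q m) * z ^ m)"
proof -
  obtain C where C: "\<And>m. norm (inverse (qpoch q q m)) \<le> C"
    using Bseq_inverse_qpoch by (auto simp: Bseq_def)
  show ?thesis
  proof (rule summable_comparison_test')
    show "summable (\<lambda>m. C * \<bar>z\<bar> ^ m)"
      using assms by (intro summable_mult summable_geometric) simp
    show "norm (inverse (qpoch q q m) * z ^ m) \<le> C * \<bar>z\<bar> ^ m" for m
      using mult_right_mono[OF C[of m], of "\<bar>z\<bar> ^ m"] by (simp add: abs_mult power_abs)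
  qed
qed

text \<open>Euler's identity \<open>\<Sum> z\<^sup>m / (q;q)\<^sub>m = 1 / (z;q)\<^sub>\<infinity>\<close>. The sum \<open>e\<close> satisfies
  \<open>(1 - z) e(z) = e(q z)\<close>, hence \<open>e(z) (z;q)\<^sub>N = e(q\<^sup>N z)\<close>, and the right-hand side tends to \<open>e(0) = 1\<close>.\<close>

lemma euler_series:
  assumes z: "0 < z" "z < 1"
  shows "(\<lambda>m. inverse (qpoch q q m) * z ^ m) sums inverse (qpoch_inf z q)"
proof -
  define a where "a m = inverse (qpoch q q m)" for m
  define e where "e y = (\<Sum>m. a m * y ^ m)" for y
  have summ: "summable (\<lambda>m. a m * y ^ m)" if "\<bar>y\<bar> < 1" for y
    unfolding a_def by (rule summable_euler_series[OF that])
  have a_Suc: "(1 - q ^ Suc m) * a (Suc m) = a m" for m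
    using one_minus_q_power_pos[OF q, of "Suc m"] by (simp add: a_def qpoch_Suc)
  have e_shift: "(1 - y) * e y = e (y * q)" if "\<bar>y\<bar> < 1" for y
  proof -
    have "\<bar>y * q\<bar> < 1"
      using that q by (simp add: abs_mult) (smt (verit) mult_left_le abs_ge_zero)
    note s = summ[OF that] summ[OF this]
    have "e y - e (y * q) = (\<Sum>m. a m * y ^ m - a m * (y * q) ^ m)"
      unfolding e_def by (rule suminf_diff[OF s])
    also have "\<dots> = (\<Sum>m. a (Suc m) * y ^ Suc m - a (Suc m) * (y * q) ^ Suc m)"
      by (subst suminf_split_head[OF summable_diff[OF s]]) simp
    also have "\<dots> = (\<Sum>m. y * (a m * y ^ m))"
    proof -
      have "a (Suc m) * y ^ Suc m - a (Suc m) * (y * q) ^ Suc m =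
          y * (((1 - q ^ Suc m) * a (Suc m)) * y ^ m)" for m
        by (simp add: algebra_simps power_mult_distrib)
      then show ?thesis
        unfolding a_Suc by simp
    qed
    also have "\<dots> = y * e y"
      unfolding e_def by (rule suminf_mult[OF s(1)])
    finally show ?thesis
      by (simp add: algebra_simps)
  qed
  have node_le: "z * q ^ N \<le> z" for N
    using q z by (intro mult_left_le power_le_one) simp_all
  have e_iter: "e z * qpoch z q N = e (z * q ^ N)" for N
  proof (induction N)
    case 0
    show ?case using q by simp
  next
    case (Suc N)
    have "0 < z * q ^ N"
      using q z by simp
    then have "\<bar>z * q ^ N\<bar> < 1"
      using node_le[of N] z by linarith
    note shift = e_shift[OF this]
    have "e z * qpoch z q (Suc N) = (1 - z * q ^ N) * (e z * qpoch z q N)"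
      by (simp add: qpoch_Suc)
    also have "\<dots> = e (z * q ^ Suc N)"
      unfolding Suc.IH shift by (simp add: mult_ac)
    finally show ?case .
  qed
  have "e \<midarrow>0\<rightarrow> a 0"
    by (rule powser_limit_0[of 1]) (auto simp: e_def intro!: summable_sums summ)
  moreover have "filterlim (\<lambda>N. z * q ^ N) (at 0) sequentially"
    unfolding filterlim_at
    by (intro conjI tendsto_mult_right_zero LIMSEQ_power_zero always_eventually) (use q z in auto)
  ultimately have "(\<lambda>N. e (z * q ^ N)) \<longlonglongrightarrow> a 0"
    by (rule filterlim_compose)
  moreover have nz: "z * q ^ i \<noteq> 1" for i
    using node_le[of i] z by linarith
  have "(\<lambda>N. e (z * q ^ N)) \<longlonglongrightarrow> e z * qpoch_inf z q"
    using tendsto_mult[OF tendsto_const[of "e z"] qpoch_inf_tendsto_nonzero(1)[OF nz]] by (simp only: e_iter)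
  ultimately have "e z * qpoch_inf z q = a 0"
    using LIMSEQ_unique by blast
  then have "e z = inverse (qpoch_inf z q)"
    using qpoch_inf_tendsto_nonzero(2)[OF nz] by (simp add: a_def inverse_eq_divide eq_divide_eq)
  moreover have "(\<lambda>m. a m * z ^ m) sums e z"
    unfolding e_def by (rule summable_sums[OF summ]) (use z in simp)
  ultimately show ?thesis
    by (simp only: a_def)
qed

end

text \<open>The weight \<open>w(x) = (qx,-qx;q)\<^sub>\<infinity>\<close> is even; this is its common value at the two nodes
  \<open>\<plusminus>q\<^sup>m\<close> of the Jackson integral.\<close>

definition jackson_weight :: "real \<Rightarrow> nat \<Rightarrow> real" where
  "jackson_weight q m = qpoch_inf (q ^ Suc m) q * qpoch_inf (- (q ^ Suc m)) q"

context
  fixes q :: real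
  assumes q: "0 < q" "q < 1"
begin

lemma q_square: "0 < q\<^sup>2" "q\<^sup>2 < 1"
  using q by (simp_all add: power_less_one_iff)

lemma qpoch_split_parity: "qpoch q q (2 * n) = qpoch q (q\<^sup>2) n * qpoch (q\<^sup>2) (q\<^sup>2) n"
proof (induction n)
  case (Suc n)
  have "q * q ^ (2 * n) = q * (q\<^sup>2) ^ n" "q * q ^ Suc (2 * n) = q\<^sup>2 * (q\<^sup>2) ^ n"
    by (simp_all add: power_mult power2_eq_square)
  then show ?case
    using Suc by (simp add: qpoch_Suc qpoch_Suc del: power_Suc)
qed (simp add: qpoch_def)

lemma qpoch_square: "qpoch (q\<^sup>2) (q\<^sup>2) n = qpoch q q n * qpoch (- q) q n"
proof (induction n)
  case (Suc n)
  have "1 - q\<^sup>2 * (q\<^sup>2) ^ n = (1 - q * q ^ n) * (1 - - q * q ^ n)"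
    by (simp add: algebra_simps power2_eq_square power_mult_distrib)
  then show ?case
    using Suc by (simp add: qpoch_Suc qpoch_Suc)
qed (simp add: qpoch_def)

text \<open>Euler's \<open>(-q;q)\<^sub>\<infinity> (q;q\<^sup>2)\<^sub>\<infinity> = 1\<close>. In \<open>(q;q)\<^sub>2\<^sub>n = (q;q\<^sup>2)\<^sub>n (q;q)\<^sub>n (-q;q)\<^sub>n\<close> the left-hand side and
  the middle factor have the same limit \<open>(q;q)\<^sub>\<infinity>\<close>, which is nonzero and cancels.\<close>

lemma qpoch_inf_minus: "qpoch_inf (- q) q = inverse (qpoch_inf q (q\<^sup>2))"
proof -
  have "q * (q\<^sup>2) ^ i \<noteq> 1" for i
    using qpoch_factors_nonzero(1)[OF q, of 0 "2 * i"] by (simp add: power_mult)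
  note odd = qpoch_inf_tendsto_nonzero[OF q_square this]
  note lim = qpoch_inf_lim(1)[OF q, of 0, simplified]
  have "(\<lambda>n. qpoch q q (2 * n)) \<longlonglongrightarrow> qpoch_inf q q"
    using LIMSEQ_subseq_LIMSEQ[OF lim, of "\<lambda>n. 2 * n"] by (simp add: strict_mono_def o_def)
  moreover have "(\<lambda>n. qpoch q q (2 * n)) \<longlonglongrightarrow>
      qpoch_inf q (q\<^sup>2) * (qpoch_inf q q * qpoch_inf (- q) q)"
    unfolding qpoch_split_parity qpoch_square
    using odd(1) lim qpoch_inf_lim(2)[OF q, of 1] by (intro tendsto_mult) simp_all
  ultimately have "qpoch_inf q q = qpoch_inf q (q\<^sup>2) * (qpoch_inf q q * qpoch_inf (- q) q)"
    using LIMSEQ_unique by blast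
  then show ?thesis
    using odd(2) qpoch_inf_nz(1)[OF q, of 0] by (simp add: field_simps)
qed

lemma qpoch_inf_minus_1: "qpoch_inf (- 1) q = 2 * qpoch_inf (- q) q"
proof -
  have "qpoch_inf (- 1) q = (1 - (- 1)) * qpoch_inf (- 1 * q) q"
    by (rule qpoch_inf_shift[OF q]) (use qpoch_factors_nonzero(2)[OF q, of 0] in simp)
  then show ?thesis by simp
qed

text \<open>This is \<open>(x\<^sup>2;q\<^sup>2)\<^sub>\<infinity> = (1 - x\<^sup>2) (q\<^sup>2x\<^sup>2;q\<^sup>2)\<^sub>\<infinity>\<close> at the nodes: the
  Pearson equation of the weight, which later makes summation by parts work.\<close>

lemma jackson_weight_Suc:
  "(1 - q ^ (2 * Suc m)) * jackson_weight q (Suc m) = jackson_weight q m"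
proof -
  have "qpoch_inf (q ^ Suc m) q = (1 - q ^ Suc m) * qpoch_inf (q ^ Suc m * q) q"
    by (rule qpoch_inf_shift[OF q qpoch_factors_nonzero(1)[OF q]])
  moreover have "qpoch_inf (- (q ^ Suc m)) q = (1 - - (q ^ Suc m)) * qpoch_inf (- (q ^ Suc m) * q) q"
    by (rule qpoch_inf_shift[OF q qpoch_factors_nonzero(2)[OF q]])
  moreover have "(1 - q ^ Suc m) * (1 - - (q ^ Suc m)) = 1 - q ^ (2 * Suc m)"
    by (simp only: mult_2 power_add) (simp add: algebra_simps)
  moreover have "q ^ Suc m * q = q ^ Suc (Suc m)"
    by simp
  ultimately show ?thesis
    unfolding jackson_weight_def
    by (simp only: mult_minus_left) (simp add: mult_ac del: power_Suc)
qed

lemma jackson_weight_eq: "jackson_weight q m = jackson_weight q 0 / qpoch (q\<^sup>2) (q\<^sup>2) m"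
proof (induction m)
  case 0
  show ?case by (simp add: qpoch_def)
next
  case (Suc m)
  have "1 - q ^ (2 * Suc m) > 0"
    by (rule one_minus_q_power_pos[OF q]) simp
  then have "jackson_weight q (Suc m) = jackson_weight q m / (1 - q ^ (2 * Suc m))"
    using jackson_weight_Suc[of m] by (simp add: field_simps del: mult_Suc_right power_Suc)
  moreover have "q\<^sup>2 * (q\<^sup>2) ^ m = q ^ (2 * Suc m)"
    by (metis power_Suc power_mult)
  ultimately show ?case
    by (simp only: Suc.IH qpoch_Suc divide_divide_eq_left)
qed

lemma convergent_jackson_weight: "convergent (jackson_weight q)"
proof -
  have "(\<lambda>m. jackson_weight q 0 / qpoch (q\<^sup>2) (q\<^sup>2) m)
      \<longlonglongrightarrow> jackson_weight q 0 / qpoch_inf (q\<^sup>2) (q\<^sup>2)"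
    using qpoch_inf_lim(1)[OF q_square, of 0] qpoch_inf_nz(1)[OF q_square, of 0]
    by (intro tendsto_divide tendsto_const) simp_all
  then show ?thesis
    unfolding jackson_weight_eq[symmetric] by (rule convergentI)
qed

text \<open>By \<open>w(q\<^sup>m) = w(1) / (q\<^sup>2;q\<^sup>2)\<^sub>m\<close> the mass of the weight is Euler's series to the base \<open>q\<^sup>2\<close> at \<open>z = q\<close>.\<close>

lemma sums_jackson_weight: "(\<lambda>m. q ^ m * jackson_weight q m) sums
    (qpoch_inf q q * qpoch_inf (- q) q * qpoch_inf (- q) q)"
proof -
  have "(\<lambda>m. inverse (qpoch (q\<^sup>2) (q\<^sup>2) m) * q ^ m) sums inverse (qpoch_inf q (q\<^sup>2))"
    by (rule euler_series[OF q_square q])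
  then have "(\<lambda>m. jackson_weight q 0 * (inverse (qpoch (q\<^sup>2) (q\<^sup>2) m) * q ^ m)) sums
     (jackson_weight q 0 * inverse (qpoch_inf q (q\<^sup>2)))"
    by (rule sums_mult)
  moreover have "jackson_weight q 0 * (inverse (qpoch (q\<^sup>2) (q\<^sup>2) m) * q ^ m) =
      q ^ m * jackson_weight q m" for m
    using jackson_weight_eq[of m] by (simp add: divide_inverse)
  ultimately have "(\<lambda>m. q ^ m * jackson_weight q m) sums
     (jackson_weight q 0 * inverse (qpoch_inf q (q\<^sup>2)))"
    by (simp only:)
  moreover have "jackson_weight q 0 = qpoch_inf q q * qpoch_inf (- q) q"
    by (simp add: jackson_weight_def)
  ultimately show ?thesis
    by (simp only: qpoch_inf_minus[symmetric])
qed

end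

section \<open>The orthogonality functional of the \<open>q\<close>-Hermite I polynomials\<close>

definition jackson_functional :: "real \<Rightarrow> real poly \<Rightarrow> real" where
  "jackson_functional q p =
     qintegral q (\<lambda>x. poly p x * (qpoch_inf (q * x) q * qpoch_inf (- (q * x)) q))"

context
  fixes q :: real
  assumes q: "0 < q" "q < 1"
begin

lemma jackson_functional_eq: "jackson_functional q p =
    (1 - q) * (\<Sum>m. q ^ m * (jackson_weight q m * (poly p (q ^ m) + poly p (- (q ^ m)))))"
  unfolding jackson_functional_def qintegral_def jackson_weight_def
  by (simp add: algebra_simps)

lemma tendsto_poly_nodes:
  "(\<lambda>m. poly p (q ^ m)) \<longlonglongrightarrow> poly p 0" "(\<lambda>m. poly p (- (q ^ m))) \<longlonglongrightarrow> poly p 0"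
proof -
  have lim: "(\<lambda>m. q ^ m) \<longlonglongrightarrow> 0"
    using q by (intro LIMSEQ_power_zero) simp
  show "(\<lambda>m. poly p (q ^ m)) \<longlonglongrightarrow> poly p 0"
    by (intro tendsto_intros lim)
  have "(\<lambda>m. - (q ^ m)) \<longlonglongrightarrow> 0"
    using tendsto_minus[OF lim] by simp
  then show "(\<lambda>m. poly p (- (q ^ m))) \<longlonglongrightarrow> poly p 0"
    by (intro tendsto_intros)
qed

text \<open>The terms are a convergent, hence bounded, sequence times \<open>q\<^sup>m\<close>.\<close>

lemma summable_jackson_functional:
  "summable (\<lambda>m. q ^ m * (jackson_weight q m * (poly p (q ^ m) + poly p (- (q ^ m)))))"
proof -
  obtain W where W: "jackson_weight q \<longlonglongrightarrow> W"
    using convergent_jackson_weight[OF q] by (auto simp: convergent_def)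
  have "(\<lambda>m. jackson_weight q m * (poly p (q ^ m) + poly p (- (q ^ m))))
      \<longlonglongrightarrow> W * (poly p 0 + poly p 0)"
    by (intro tendsto_mult tendsto_add W tendsto_poly_nodes)
  then have "Bseq (\<lambda>m. jackson_weight q m * (poly p (q ^ m) + poly p (- (q ^ m))))"
    by (rule convergent_imp_Bseq[OF convergentI])
  then obtain C where "0 < C"
    and C: "\<forall>m. norm (jackson_weight q m * (poly p (q ^ m) + poly p (- (q ^ m)))) \<le> C"
    by (rule BseqE)
  show ?thesis
  proof (rule summable_comparison_test')
    show "summable (\<lambda>m. q ^ m * C)"
      using q by (intro summable_mult2 summable_geometric) simp
    show "norm (q ^ m * (jackson_weight q m * (poly p (q ^ m) + poly p (- (q ^ m))))) \<le> q ^ m * C" for m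
      using mult_left_mono[OF spec[OF C, of m], of "q ^ m"] q
      by (simp add: abs_mult[of "q ^ m"])
  qed
qed

lemma jackson_functional_add:
  "jackson_functional q (p + r) = jackson_functional q p + jackson_functional q r"
  unfolding jackson_functional_eq distrib_left[symmetric]
  by (subst suminf_add[OF summable_jackson_functional summable_jackson_functional])
     (simp add: algebra_simps)

lemma jackson_functional_smult:
  "jackson_functional q (smult c p) = c * jackson_functional q p"
  using suminf_mult[OF summable_jackson_functional, of c p]
  unfolding jackson_functional_eq by (simp add: algebra_simps)

lemma jackson_functional_1: "jackson_functional q 1 = qHermite_norm2 q 0"
proof -
  have "(\<lambda>m. q ^ m * (jackson_weight q m * (poly 1 (q ^ m) + poly 1 (- (q ^ m))))) sums
     (2 * (qpoch_inf q q * qpoch_inf (- q) q * qpoch_inf (- q) q))"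
    using sums_mult[OF sums_jackson_weight[OF q], of 2] by (simp add: mult_ac)
  then show ?thesis
    by (simp add: jackson_functional_eq sums_iff qHermite_norm2_def numeral_2_eq_2 mult_ac
        qpoch_inf_minus_1[OF q])
qed

text \<open>Summation by parts, \<open>L(x p) = (1 - q) L(D\<^sub>q p)\<close>: the difference of the two integrands is, up
  to the factor \<open>1 - q\<close>, the \<open>q\<close>-derivative of \<open>p(x) (x\<^sup>2;q\<^sup>2)\<^sub>\<infinity>\<close>, whose Jackson integral telescopes. The boundary term at
  \<open>\<plusminus>1\<close> is zero because of the factor \<open>1 - x\<^sup>2\<close>, and the one at \<open>0\<close> because
  \<open>p(q\<^sup>m) - p(-q\<^sup>m)\<close> tends to zero. With \<open>L(1)\<close> this rule determines \<open>L\<close>, so that all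
  orthogonality relations become algebra.\<close>

lemma jackson_functional_pCons_0:
  "jackson_functional q (pCons 0 p) = (1 - q) * jackson_functional q (qderiv_poly q p)"
proof -
  define r where "r m = poly p (q ^ m) - poly p (- (q ^ m))" for m
  \<comment> \<open>the antiderivative at \<open>x = q\<^sup>m\<close> minus its value at \<open>-x\<close>, with \<open>(x\<^sup>2;q\<^sup>2)\<^sub>\<infinity>\<close> written as \<open>(1 - x\<^sup>2) w(x)\<close>\<close>
  define v where "v m = jackson_weight q m * (1 - q ^ (2 * m)) * r m" for m
  have v_Suc: "v (Suc m) = jackson_weight q m * r (Suc m)" for m
    using jackson_weight_Suc[OF q, of m] by (simp add: v_def mult_ac del: mult_Suc_right)
  obtain W where W: "jackson_weight q \<longlonglongrightarrow> W"
    using convergent_jackson_weight[OF q] by (auto simp: convergent_def)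
  have "(\<lambda>m. jackson_weight q m * r (Suc m)) \<longlonglongrightarrow> W * (poly p 0 - poly p 0)"
    unfolding r_def by (intro tendsto_mult tendsto_diff W LIMSEQ_Suc[OF tendsto_poly_nodes(1)]
        LIMSEQ_Suc[OF tendsto_poly_nodes(2)])
  then have "(\<lambda>m. v (Suc m)) \<longlonglongrightarrow> 0"
    by (simp add: v_Suc)
  then have "v \<longlonglongrightarrow> 0"
    by (rule LIMSEQ_imp_Suc)
  from telescope_sums'[OF this] have v_sums: "(\<lambda>m. v m - v (Suc m)) sums 0"
    by (simp add: v_def)
  let ?t = "\<lambda>p m. q ^ m * (jackson_weight q m * (poly p (q ^ m) + poly p (- (q ^ m))))"
  have "v m - v (Suc m) = (1 - q) * ?t (qderiv_poly q p) m - ?t (pCons 0 p) m" for m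
  proof -
    have "(1 - q) * q ^ m * poly (qderiv_poly q p) (q ^ m) = poly p (q ^ m) - poly p (q ^ Suc m)"
      using poly_qderiv_poly_times[OF q, of "q ^ m" p] by (simp add: algebra_simps)
    moreover have "(1 - q) * q ^ m * poly (qderiv_poly q p) (- (q ^ m)) =
        poly p (- (q ^ Suc m)) - poly p (- (q ^ m))"
      using poly_qderiv_poly_times[OF q, of "- (q ^ m)" p] by (simp add: algebra_simps)
    moreover have "(1 - q) * ?t (qderiv_poly q p) m = jackson_weight q m *
        ((1 - q) * q ^ m * poly (qderiv_poly q p) (q ^ m) +
         (1 - q) * q ^ m * poly (qderiv_poly q p) (- (q ^ m)))"
      by (simp add: algebra_simps)
    ultimately have D: "(1 - q) * ?t (qderiv_poly q p) m = jackson_weight q m * (r m - r (Suc m))"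
      by (simp only: r_def) (simp add: algebra_simps)
    have "?t (pCons 0 p) m = jackson_weight q m * q ^ (2 * m) * r m"
      by (simp only: r_def mult_2 power_add) (simp add: algebra_simps)
    then show ?thesis
      unfolding D v_Suc by (simp add: v_def algebra_simps)
  qed
  then have "(\<Sum>m. (1 - q) * ?t (qderiv_poly q p) m - ?t (pCons 0 p) m) = 0"
    using v_sums by (simp add: sums_iff)
  moreover have "(\<Sum>m. (1 - q) * ?t (qderiv_poly q p) m - ?t (pCons 0 p) m) =
      (1 - q) * (\<Sum>m. ?t (qderiv_poly q p) m) - (\<Sum>m. ?t (pCons 0 p) m)"
    using suminf_diff[OF summable_mult[OF summable_jackson_functional[of "qderiv_poly q p"], of "1 - q"]
        summable_jackson_functional[of "pCons 0 p"]]
      suminf_mult[OF summable_jackson_functional[of "qderiv_poly q p"], of "1 - q"]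
    by simp
  ultimately show ?thesis
    unfolding jackson_functional_eq by simp
qed

end

lemma monic_family_expansion:
  fixes P :: "nat \<Rightarrow> 'a::comm_ring_1 poly"
  assumes P: "\<And>n. degree (P n) \<le> n" "\<And>n. coeff (P n) n = 1"
    and p: "\<And>k. k \<ge> n \<Longrightarrow> coeff p k = 0"
  shows "\<exists>c. p = (\<Sum>k<n. smult (c k) (P k))"
  using p
proof (induction n arbitrary: p)
  case 0
  then show ?case
    by (auto intro: poly_eqI)
next
  case (Suc n)
  have "coeff (p - smult (coeff p n) (P n)) k = 0" if "k \<ge> n" for k
  proof (cases "k = n")
    case True
    then show ?thesis using P(2)[of n] by simp
  next
    case False
    then have "coeff (P n) k = 0"
      using that P(1)[of n] by (intro coeff_eq_0) simp
    then show ?thesis using Suc.prems[of k] that False by simp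
  qed
  then obtain c where c: "p - smult (coeff p n) (P n) = (\<Sum>k<n. smult (c k) (P k))"
    using Suc.IH by blast
  have "p = (\<Sum>k<Suc n. smult ((c(n := coeff p n)) k) (P k))"
    using c by (simp add: diff_eq_eq)
  then show ?case by blast
qed

context
  fixes q :: real
  assumes q: "0 < q" "q < 1"
begin

lemma jackson_functional_0: "jackson_functional q 0 = 0"
  using jackson_functional_smult[OF q, of 0 0] by simp

lemma jackson_functional_sum:
  "jackson_functional q (\<Sum>i\<in>A. p i) = (\<Sum>i\<in>A. jackson_functional q (p i))"
  by (induction A rule: infinite_finite_induct)
     (simp_all add: jackson_functional_0 jackson_functional_add[OF q])

lemma jackson_functional_diff:
  "jackson_functional q (p - r) = jackson_functional q p - jackson_functional q r"
  using jackson_functional_add[OF q, of p "smult (- 1) r"] jackson_functional_smult[OF q, of "- 1" r]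
  by simp

text \<open>By the recurrence and summation by parts, \<open>L(H\<^sub>n\<^sub>+\<^sub>2)\<close> is \<open>(1 - q\<^sup>n\<^sup>+\<^sup>1) (1 - q\<^sup>n)\<close> times \<open>L(H\<^sub>n)\<close>.
  The factor \<open>1 - q\<^sup>n\<close> is zero at \<open>n = 0\<close>, which settles even degrees; odd ones go back to \<open>L(H\<^sub>1) = 0\<close>.\<close>

lemma jackson_functional_qHermite: "jackson_functional q (qHermite q (Suc n)) = 0"
proof (induction n rule: induct_nat_012)
  case 0
  have "qHermite q (Suc 0) = pCons 0 1"
    by (simp add: qHermite_1[OF q] one_pCons)
  then show ?case
    by (simp add: jackson_functional_pCons_0[OF q] jackson_functional_0 del: pCons_one)
next
  case 1
  show ?case
    unfolding One_nat_def qHermite_Suc_Suc[OF q] jackson_functional_diff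
      jackson_functional_pCons_0[OF q] jackson_functional_smult[OF q] qderiv_poly_qHermite[OF q]
    using q by (simp add: qnum_def)
next
  case (ge2 n)
  then show ?case
    by (subst qHermite_Suc_Suc[OF q])
       (simp add: jackson_functional_diff jackson_functional_pCons_0[OF q]
        jackson_functional_smult[OF q] qderiv_poly_qHermite[OF q])
qed

lemma qHermite_norm2_Suc:
  "qHermite_norm2 q (Suc n) = q ^ n * (1 - q ^ Suc n) * qHermite_norm2 q n"
  by (simp add: qHermite_norm2_def qpoch_Suc choose_2_Suc power_add)

lemma qHermite_norm2_pos: "qHermite_norm2 q n > 0"
proof (induction n)
  case 0
  have "qpoch_inf q q \<ge> 0"
    by (rule LIMSEQ_le_const[OF qpoch_inf_lim(1)[OF q, of 0, simplified]])
       (auto intro: less_imp_le qpoch_q_pos[OF q])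
  then have "qpoch_inf q q > 0"
    using qpoch_inf_nz(1)[OF q, of 0] by simp
  moreover have "qpoch_inf (- q) q * qpoch_inf (- q) q > 0"
    using qpoch_inf_nz(2)[OF q, of 1] by (simp add: zero_less_mult_iff) linarith
  ultimately have "qpoch_inf q q * (qpoch_inf (- q) q * qpoch_inf (- q) q) > 0"
    by (rule mult_pos_pos)
  then have "qpoch_inf q q * qpoch_inf (- 1) q * qpoch_inf (- q) q > 0"
    by (simp add: qpoch_inf_minus_1[OF q] mult_ac)
  then show ?case
    using q by (simp add: qHermite_norm2_def numeral_2_eq_2)
next
  case (Suc n)
  then show ?case
    using q one_minus_q_power_pos[OF q, of "Suc n"] by (simp add: qHermite_norm2_Suc)
qed

lemma pCons_0_qHermite_Suc:
  "pCons 0 (qHermite q (Suc n)) =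
     qHermite q (Suc (Suc n)) + smult (q ^ n * (1 - q ^ Suc n)) (qHermite q n)"
  by (simp add: qHermite_Suc_Suc[OF q])

text \<open>Trading \<open>x H\<^sub>n\<close> for \<open>H\<^sub>n\<^sub>+\<^sub>1 + \<gamma>\<^sub>n H\<^sub>n\<^sub>-\<^sub>1\<close> moves the monomial into the index. On the diagonal only the lower
  term survives, and \<open>\<gamma>\<^sub>n\<close> is the ratio of consecutive norms.\<close>

lemma jackson_functional_qHermite_monom:
  "k \<le> n \<Longrightarrow> jackson_functional q (qHermite q n * monom 1 k) =
     (if k = n then qHermite_norm2 q n else 0)"
proof (induction k arbitrary: n)
  case 0
  show ?case
  proof (cases n)
    case 0
    then show ?thesis by (simp add: jackson_functional_1[OF q] q)
  next
    case (Suc m)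
    then show ?thesis by (simp add: jackson_functional_qHermite monom_0 one_pCons)
  qed
next
  case (Suc k)
  then obtain m where m: "n = Suc m" "k \<le> m"
    by (cases n) auto
  have "qHermite q n * monom 1 (Suc k) = pCons 0 (qHermite q (Suc m)) * monom 1 k"
    by (simp add: m monom_Suc)
  also have "\<dots> = qHermite q (Suc (Suc m)) * monom 1 k
      + smult (q ^ m * (1 - q ^ Suc m)) (qHermite q m * monom 1 k)"
    unfolding pCons_0_qHermite_Suc by (simp add: algebra_simps)
  finally show ?case
    using Suc.IH[of "Suc (Suc m)"] Suc.IH[of m] m
    by (simp add: jackson_functional_add[OF q] jackson_functional_smult[OF q] qHermite_norm2_Suc)
qed

lemma jackson_functional_qHermite_mult:
  assumes "degree p \<le> n"
  shows "jackson_functional q (qHermite q n * p) = coeff p n * qHermite_norm2 q n"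
proof -
  have "p = (\<Sum>k\<le>n. smult (coeff p k) (monom 1 k))"
    using poly_as_sum_of_monoms'[OF assms] by (simp add: smult_monom)
  then have "jackson_functional q (qHermite q n * p) =
      jackson_functional q (\<Sum>k\<le>n. smult (coeff p k) (qHermite q n * monom 1 k))"
    by (metis (no_types, lifting) mult_smult_right sum.cong sum_distrib_left)
  also have "\<dots> = (\<Sum>k\<le>n. coeff p k * (if k = n then qHermite_norm2 q n else 0))"
    by (simp add: jackson_functional_sum jackson_functional_smult[OF q]
        jackson_functional_qHermite_monom)
  finally show ?thesis
    by (simp add: if_distrib cong: if_cong)
qed

lemma jackson_functional_qHermite_orthogonal:
  "jackson_functional q (qHermite q m * qHermite q n) = (if m = n then qHermite_norm2 q n else 0)"
proof -
  have *: "jackson_functional q (qHermite q a * qHermite q b) = 0" if "b < a" for a b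
  proof -
    have "degree (qHermite q b) < a"
      using degree_le_qHermite[OF q, of b] that by simp
    then show ?thesis
      using jackson_functional_qHermite_mult[of "qHermite q b" a] by (simp add: coeff_eq_0)
  qed
  show ?thesis
    using *[of m n] *[of n m] jackson_functional_qHermite_mult[OF degree_le_qHermite[OF q, of n]]
    by (cases m n rule: linorder_cases) (simp_all add: mult.commute coeff_qHermite_top[OF q])
qed

section \<open>Connection with the Sobolev polynomials\<close>

lemma sobolev_ip_eq:
  "sobolev_ip q lam j \<alpha> f g = jackson_functional q (f * g)
     + lam * poly ((qderiv_poly q ^^ j) f) \<alpha> * poly ((qderiv_poly q ^^ j) g) \<alpha>"
  by (simp add: sobolev_ip_def jackson_functional_def funpow_qderiv_poly_eq[OF q])

lemma sobolev_ip_sum_right: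
  "sobolev_ip q lam j \<alpha> f (\<Sum>i\<in>A. smult (c i) (g i)) = (\<Sum>i\<in>A. c i * sobolev_ip q lam j \<alpha> f (g i))"
  by (simp add: sobolev_ip_eq sum_distrib_left jackson_functional_sum sum.distrib poly_sum
      jackson_functional_smult[OF q] algebra_simps)

text \<open>In \<open>\<H>\<^sub>n = H\<^sub>n + \<Sum> c\<^sub>k H\<^sub>k\<close> the Sobolev orthogonality to \<open>H\<^sub>k\<close> reads
  \<open>c\<^sub>k \<parallel>H\<^sub>k\<parallel>\<^sup>2 + \<lambda> T D\<^sup>j H\<^sub>k(\<alpha>) = 0\<close> with \<open>T = D\<^sup>j \<H>\<^sub>n(\<alpha>)\<close>. So the correction is a
  multiple of the kernel, with the still unknown \<open>T\<close> as a factor.\<close>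

lemma sobolev_monic_ops_expansion:
  assumes "is_sobolev_monic_ops q lam j \<alpha> P"
  shows "P n = qHermite q n - smult
     (lam * poly ((qderiv_poly q ^^ j) (P n)) \<alpha>)
     (\<Sum>k<n. smult (DqH q j k \<alpha> / qHermite_norm2 q k) (qHermite q k))"
proof -
  have P: "degree (P k) \<le> k" "coeff (P k) k = 1" for k
    using assms unfolding is_sobolev_monic_ops_def by (metis order_refl)+
  have orth: "sobolev_ip q lam j \<alpha> (P n) (P k) = 0" if "k < n" for k
    using assms that by (simp add: is_sobolev_monic_ops_def)
  define T where "T = poly ((qderiv_poly q ^^ j) (P n)) \<alpha>"
  have "coeff (P n - qHermite q n) k = 0" if "k \<ge> n" for k
  proof (cases "k = n")
    case True
    then show ?thesis by (simp add: P(2) coeff_qHermite_top[OF q])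
  next
    case False
    then show ?thesis
      using that P(1)[of n] degree_le_qHermite[OF q, of n] by (simp add: coeff_eq_0)
  qed
  then obtain c where "P n - qHermite q n = (\<Sum>k<n. smult (c k) (qHermite q k))"
    using monic_family_expansion[of "qHermite q" n "P n - qHermite q n"]
      degree_le_qHermite[OF q] coeff_qHermite_top[OF q] by blast
  then have c: "P n = qHermite q n + (\<Sum>k<n. smult (c k) (qHermite q k))"
    by (simp add: algebra_simps)
  have "c i = - (lam * T * (DqH q j i \<alpha> / qHermite_norm2 q i))" if i: "i < n" for i
  proof -
    have "coeff (qHermite q i) k = 0" if "k \<ge> n" for k
      using that i degree_le_qHermite[OF q, of i] by (intro coeff_eq_0) simp
    then obtain d where "qHermite q i = (\<Sum>k<n. smult (d k) (P k))"
      using monic_family_expansion[of P n "qHermite q i"] P by blast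
    then have "sobolev_ip q lam j \<alpha> (P n) (qHermite q i) = 0"
      by (simp add: sobolev_ip_sum_right orth)
    moreover have "jackson_functional q (P n * qHermite q i) = c i * qHermite_norm2 q i"
    proof -
      have "jackson_functional q (P n * qHermite q i) =
          (\<Sum>k<n. c k * (if k = i then qHermite_norm2 q i else 0))"
        using i by (simp add: c distrib_right sum_distrib_right jackson_functional_add[OF q]
            jackson_functional_sum jackson_functional_smult[OF q]
            jackson_functional_qHermite_orthogonal)
      also have "\<dots> = (\<Sum>k<n. if k = i then c i * qHermite_norm2 q i else 0)"
        by (rule sum.cong) auto
      finally show ?thesis
        using i by simp
    qed
    ultimately have "c i * qHermite_norm2 q i = - (lam * T * DqH q j i \<alpha>)"
      by (simp add: sobolev_ip_eq T_def DqH_eq[OF q])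
    then show ?thesis
      using qHermite_norm2_pos[of i] by (simp add: field_simps)
  qed
  then have "(\<Sum>k<n. smult (c k) (qHermite q k)) =
      (\<Sum>k<n. smult (- (lam * T)) (smult (DqH q j k \<alpha> / qHermite_norm2 q k) (qHermite q k)))"
    by (intro sum.cong) simp_all
  then show ?thesis
    unfolding T_def[symmetric] by (subst c) (simp add: smult_sum_right sum_negf)
qed

text \<open>The Christoffel-Darboux formula, with \<open>x\<close> a number and the second variable the polynomial one, so that the
  \<open>q\<close>-derivatives in the second variable can be taken by the quotient rule above.\<close>

lemma christoffel_darboux:
  "[:x, -1:] * (\<Sum>k\<le>m. smult (poly (qHermite q k) x / qHermite_norm2 q k) (qHermite q k)) =
     smult (1 / qHermite_norm2 q m)
       (smult (poly (qHermite q (Suc m)) x) (qHermite q m)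
        - smult (poly (qHermite q m) x) (qHermite q (Suc m)))"
proof (induction m)
  case 0
  show ?case
    by (simp add: qHermite_1[OF q] one_pCons q)
next
  case (Suc m)
  let ?N = "qHermite_norm2 q (Suc m)" and ?H = "qHermite q" and ?g = "q ^ m * (1 - q ^ Suc m)"
  have N: "1 / qHermite_norm2 q m = ?g / ?N"
  proof -
    have "1 / a = g / (g * a)" if "g \<noteq> 0" for a g :: real
      using that by simp
    moreover have "?g \<noteq> 0"
      using q one_minus_q_power_pos[OF q, of "Suc m"] by simp
    ultimately show ?thesis
      unfolding qHermite_norm2_Suc by blast
  qed
  have rec: "poly (?H (Suc (Suc m))) y = y * poly (?H (Suc m)) y - ?g * poly (?H m) y" for y
    unfolding qHermite_Suc_Suc[OF q] by simp
  have "poly ([:x, -1:] * (\<Sum>k\<le>Suc m. smult (poly (?H k) x / qHermite_norm2 q k) (?H k))) y =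
     poly (smult (1 / ?N) (smult (poly (?H (Suc (Suc m))) x) (?H (Suc m))
        - smult (poly (?H (Suc m)) x) (?H (Suc (Suc m))))) y" for y
  proof -
    define S where "S = (\<Sum>k\<le>m. poly (?H k) x / qHermite_norm2 q k * poly (?H k) y)"
    have "(x - y) * S = 1 / qHermite_norm2 q m
        * (poly (?H (Suc m)) x * poly (?H m) y - poly (?H m) x * poly (?H (Suc m)) y)"
      using arg_cong[OF Suc.IH, of "\<lambda>p. poly p y"] by (simp add: S_def poly_sum algebra_simps)
    moreover have "(x - y) * (S + poly (?H (Suc m)) x / ?N * poly (?H (Suc m)) y) =
        1 / ?N * (poly (?H (Suc (Suc m))) x * poly (?H (Suc m)) y
          - poly (?H (Suc m)) x * poly (?H (Suc (Suc m))) y)"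
      unfolding distrib_left calculation N rec using qHermite_norm2_pos[of "Suc m"]
      by (simp add: divide_simps del: power_Suc) (simp add: algebra_simps del: power_Suc)
    moreover have "poly [:x, -1:] y = x - y"
      by simp
    ultimately show ?thesis
      unfolding poly_mult by (simp add: S_def poly_sum)
  qed
  then show ?case
    using poly_eq_poly_eq_iff by blast
qed

lemma qkernel_eq:
  assumes "\<And>i. i \<le> j \<Longrightarrow> x \<noteq> q ^ i * \<alpha>"
  shows "qkernel q m 0 j x \<alpha> =
    A_fun q j (Suc m) x \<alpha> * poly (qHermite q (Suc m)) x + B_fun q j (Suc m) x \<alpha> * poly (qHermite q m) x"
proof -
  define F where "F = (\<Sum>k\<le>m. smult (poly (qHermite q k) x / qHermite_norm2 q k) (qHermite q k))"
  let ?H = "\<lambda>k. poly (qHermite q k) x" and ?N = "qHermite_norm2 q m"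
  have "qkernel q m 0 j x \<alpha> = poly ((qderiv_poly q ^^ j) F) \<alpha>"
    by (simp add: qkernel_def F_def poly_sum DqH_eq[OF q])
  also have "\<dots> = qfact q j / qminus_power q x \<alpha> (j + 1) *
     (\<Sum>k\<le>j. (1 / ?N * (?H (Suc m) * DqH q k m \<alpha> - ?H m * DqH q k (Suc m) \<alpha>))
        / qfact q k * qminus_power q x \<alpha> k)"
    using qderiv_poly_linear_quotient[OF q christoffel_darboux[of x m] assms]
    unfolding F_def by (simp add: DqH_eq[OF q])
  also have "\<dots> = A_fun q j (Suc m) x \<alpha> * ?H (Suc m) + B_fun q j (Suc m) x \<alpha> * ?H m"
  proof -
    let ?S = "\<lambda>n. (\<Sum>k\<le>j. DqH q k n \<alpha> / qfact q k * qminus_power q x \<alpha> k)"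
    have sum: "(\<Sum>k\<le>j. (1 / ?N * (?H (Suc m) * DqH q k m \<alpha> - ?H m * DqH q k (Suc m) \<alpha>))
        / qfact q k * qminus_power q x \<alpha> k) = (?H (Suc m) * ?S m - ?H m * ?S (Suc m)) / ?N"
      unfolding sum_distrib_left sum_subtractf[symmetric] sum_divide_distrib
      by (rule sum.cong[OF refl]) (simp add: diff_divide_distrib algebra_simps)
    show ?thesis
      unfolding sum A_fun_def B_fun_def diff_Suc_1 by (simp add: diff_divide_distrib algebra_simps)
  qed
  finally show ?thesis .
qed

text \<open>The value \<open>T = D\<^sup>j \<H>\<^sub>n(\<alpha>)\<close> is found by differentiating the expansion of \<open>\<H>\<^sub>n\<close>:
  \<open>T (1 + \<lambda> K) = D\<^sup>j H\<^sub>n(\<alpha>)\<close>, where \<open>K \<ge> 0\<close> is the kernel at \<open>(\<alpha>,\<alpha>)\<close>. Hence \<open>\<lambda> T = c\<^sub>n\<close>.\<close>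

lemma sobolev_connection_formula:
  assumes "is_sobolev_monic_ops q lam j \<alpha> P" and "lam > 0"
    and "\<And>i. i \<le> j \<Longrightarrow> x \<noteq> q ^ i * \<alpha>"
  shows "poly (P (Suc m)) x = E1 q lam j \<alpha> (Suc m) x * poly (qHermite q (Suc m)) x
     + F1 q lam j \<alpha> (Suc m) x * poly (qHermite q m) x"
proof -
  define T where "T = poly ((qderiv_poly q ^^ j) (P (Suc m))) \<alpha>"
  let ?K = "\<lambda>i y. qkernel q m i j y \<alpha>"
  have P: "P (Suc m) = qHermite q (Suc m) - smult (lam * T)
     (\<Sum>k\<le>m. smult (DqH q j k \<alpha> / qHermite_norm2 q k) (qHermite q k))"
    using sobolev_monic_ops_expansion[OF assms(1), of "Suc m"]
    unfolding T_def lessThan_Suc_atMost .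
  have deriv: "poly ((qderiv_poly q ^^ i) (P (Suc m))) y = DqH q i (Suc m) y - lam * T * ?K i y" for i y
    unfolding P by (simp add: qkernel_def poly_sum DqH_eq[OF q] mult_ac)
  have "?K j \<alpha> \<ge> 0"
    unfolding qkernel_def using qHermite_norm2_pos by (intro sum_nonneg) (simp add: less_imp_le)
  then have "1 + lam * ?K j \<alpha> > 0"
    using \<open>lam > 0\<close> by (simp add: add_pos_nonneg)
  moreover have "T * (1 + lam * ?K j \<alpha>) = DqH q j (Suc m) \<alpha>"
    using deriv[of j \<alpha>] unfolding T_def[symmetric] by (simp add: algebra_simps)
  ultimately have "T = DqH q j (Suc m) \<alpha> / (1 + lam * ?K j \<alpha>)"
    by (simp add: eq_divide_eq)
  then have "c_coeff q lam j \<alpha> (Suc m) = lam * T"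
    by (simp add: c_coeff_def DqH_qfalling[OF q, symmetric] del: of_nat_Suc)
  then show ?thesis
    using deriv[of 0 x] qkernel_eq[OF assms(3), where m = m]
    by (simp add: E1_def F1_def DqH_def algebra_simps)
qed

end

section \<open>The basic hypergeometric representation\<close>

context
  fixes q :: real
  assumes q: "0 < q" "q < 1"
begin

lemma qpoch_inverse_power_eq_0: "k > n \<Longrightarrow> qpoch (q powi (- int n)) q k = 0"
  unfolding qpoch_def using q by (intro prod_zero bexI[of _ n]) (simp_all add: power_int_minus)

lemma qHermite_coeff_eq_0: "qHermite_coeff q n (Suc n) = 0"
  by (simp add: qHermite_coeff_def qpoch_inverse_power_eq_0)

text \<open>The last factor of \<open>(q\<^sup>-\<^sup>n;q)\<^sub>k\<^sub>+\<^sub>1\<close> is proportional to \<open>q\<^sup>n\<^sup>-\<^sup>1 - q\<^sup>k\<^sup>-\<^sup>1\<close>, and dropping the first factor instead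
  leads to degree \<open>n - 1\<close>: multiplying the coefficients of \<open>H\<^sub>n\<close> by this linear function of \<open>q\<^sup>k\<close> gives,
  up to a constant, those of \<open>H\<^sub>n\<^sub>-\<^sub>1\<close>.\<close>

lemma qHermite_coeff_lower:
  "qHermite_coeff q (Suc m) k * (q ^ m - q ^ k / q) = - ((1 - q ^ Suc m) / q) * qHermite_coeff q m k"
proof -
  let ?a = "q powi (- int (Suc m))"
  have a: "?a = inverse (q ^ Suc m)"
    by (simp only: power_int_minus power_int_of_nat)
  have top: "qpoch ?a q k * (1 - ?a * q ^ k) = (1 - inverse (q ^ Suc m)) * qpoch (q powi (- int m)) q k"
    using qpoch_inverse_power_Suc[OF q, of m k] by (simp only: qpoch_Suc)
  have diff: "q ^ m - q ^ k / q = q ^ m * (1 - ?a * q ^ k)"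
    unfolding a using q by (simp add: field_simps)
  have const: "q ^ m * (1 - inverse (q ^ Suc m)) = - ((1 - q ^ Suc m) / q)"
    using q by (simp add: field_simps)
  have "qHermite_coeff q (Suc m) k * (q ^ m - q ^ k / q) =
      q ^ m * (qpoch ?a q k * (1 - ?a * q ^ k)) / qpoch q q k * (- q) ^ k"
    unfolding diff qHermite_coeff_def by (simp only: mult_ac times_divide_eq_left times_divide_eq_right)
  also have "\<dots> = (q ^ m * (1 - inverse (q ^ Suc m))) * qHermite_coeff q m k"
    unfolding top qHermite_coeff_def by (simp only: mult_ac times_divide_eq_left times_divide_eq_right)
  finally show ?thesis
    unfolding const .
qed

text \<open>The quotient \<open>(\<psi>;q)\<^sub>k / (\<psi>/q;q)\<^sub>k\<close> telescopes to \<open>(1 - \<psi>q\<^sup>k\<^sup>-\<^sup>1) / (1 - \<psi>/q)\<close>. So the extra pair of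
  parameters only inserts a linear function of \<open>q\<^sup>k\<close> into the expansion of \<open>H\<^sub>n\<close>.\<close>

lemma phi32_eq:
  assumes x: "x \<noteq> 0" and \<psi>: "\<And>i. i < n \<Longrightarrow> \<psi> * inverse q * q ^ i \<noteq> 1"
  shows "(1 - \<psi> * inverse q) * phi32 (q powi (- int n)) (inverse x) \<psi> 0 (\<psi> * inverse q) q (- (q * x)) =
    (\<Sum>k\<le>n. qHermite_coeff q n k * poly (qroots_poly q k) x * (1 - \<psi> * (q ^ k / q)))"
proof -
  let ?b = "\<psi> * inverse q"
  have "(\<Prod>i<k. x - q ^ i) = qpoch (inverse x) q k * x ^ k" for k
    unfolding qpoch_def using x by (induction k) (auto simp: field_simps)
  then have roots: "poly (qroots_poly q k) x = qpoch (inverse x) q k * x ^ k" for k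
    by (simp add: qroots_poly_def poly_prod)
  let ?t = "\<lambda>k. (qpoch (q powi (- int n)) q k * qpoch (inverse x) q k * qpoch \<psi> q k)
      / (qpoch 0 q k * qpoch ?b q k) * ((- (q * x)) ^ k / qpoch q q k)"
  have "phi32 (q powi (- int n)) (inverse x) \<psi> 0 ?b q (- (q * x)) = (\<Sum>k\<le>n. ?t k)"
    unfolding phi32_def by (rule suminf_finite) (auto simp: qpoch_inverse_power_eq_0)
  moreover have "(1 - ?b) * ?t k =
      qHermite_coeff q n k * poly (qroots_poly q k) x * (1 - \<psi> * (q ^ k / q))" if "k \<le> n" for k
  proof -
    have nz: "qpoch ?b q k \<noteq> 0"
      using \<psi> that by (auto simp: qpoch_def)
    have "(1 - ?b) * qpoch \<psi> q k = qpoch ?b q k * (1 - ?b * q ^ k)"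
      using qpoch_Suc_shift[of ?b q k] qpoch_Suc[of ?b q k] q by (simp add: mult.assoc)
    then have ratio: "(1 - ?b) * (qpoch \<psi> q k / qpoch ?b q k) = 1 - \<psi> * (q ^ k / q)"
      using nz by (simp add: field_simps)
    have "qpoch 0 q k = 1"
      by (simp add: qpoch_def)
    moreover have "(- (q * x)) ^ k = (- q) ^ k * x ^ k"
      by (simp flip: power_mult_distrib)
    ultimately show ?thesis
      unfolding ratio[symmetric] qHermite_coeff_def roots by (simp add: mult_ac)
  qed
  ultimately show ?thesis
    by (simp add: sum_distrib_left)
qed

end

theorem proposition6:
  fixes q \<alpha> lam x :: real and j n :: nat and \<H> :: "nat \<Rightarrow> real poly"
  assumes "0 < q" "q < 1"
    and "\<bar>\<alpha>\<bar> > 1"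
    and "lam > 0"
    and "is_sobolev_monic_ops q lam j \<alpha> \<H>"
    and "n \<ge> 1"
    and "x \<noteq> 0"
    and "\<And>i. i \<le> j \<Longrightarrow> x \<noteq> q ^ i * \<alpha>"
    and "F1 q lam j \<alpha> n x \<noteq> 0"
    and "(1 - q) * vartheta q lam j \<alpha> n x + 1 \<noteq> 0"
    and "\<And>i. i \<le> n - 1 \<Longrightarrow> psi q lam j \<alpha> n x \<noteq> q powi (1 - int i)"
  shows "poly (\<H> n) x =
    - (F1 q lam j \<alpha> n x * (1 - psi q lam j \<alpha> n x * inverse q)
         * q powi (int (n choose 2) - int n + 2)
         / (qnum q n * psi q lam j \<alpha> n x * (1 - q)))
    * phi32 (q powi (- int n)) (inverse x) (psi q lam j \<alpha> n x)
            0 (psi q lam j \<alpha> n x * inverse q) q (- (q * x))"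
proof -
  note q = assms(1,2)
  obtain m where n: "n = Suc m"
    using \<open>n \<ge> 1\<close> by (cases n) auto
  define E where "E = E1 q lam j \<alpha> n x"
  define F where "F = F1 q lam j \<alpha> n x"
  define \<psi> where "\<psi> = psi q lam j \<alpha> n x"
  define h where "h k = qHermite_coeff q n k * poly (qroots_poly q k) x" for k
  \<comment> \<open>the prefactor of \<open>H\<^sub>n\<^sub>-\<^sub>1\<close>; the one of \<open>H\<^sub>n\<close> is \<open>q ^ m * C\<close>\<close>
  define C where "C = q ^ (m choose 2)"
  define g where "g = 1 - q ^ n"
  have nz: "F \<noteq> 0" "q \<noteq> 0" "1 - q \<noteq> 0" "C \<noteq> 0" "q ^ m \<noteq> 0" "\<psi> \<noteq> 0"
    using assms by (auto simp: F_def C_def \<psi>_def psi_def)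
  have g: "g \<noteq> 0" "qnum q n * (1 - q) = g"
    using one_minus_q_power_pos[OF q, of n] nz n by (auto simp: g_def qnum_def)
  have H_n: "poly (qHermite q n) x = q ^ m * C * (\<Sum>k\<le>n. h k)"
    by (simp add: qHermite_altdef[OF q] n choose_2_Suc C_def h_def poly_sum power_add)
  have H_m: "q * (\<Sum>k\<le>n. h k * (q ^ m - q ^ k / q)) * C = - g * poly (qHermite q m) x"
  proof -
    have "h k * (q ^ m - q ^ k / q) = - (g / q) * (qHermite_coeff q m k * poly (qroots_poly q k) x)" for k
    proof -
      have "h k * (q ^ m - q ^ k / q) =
          qHermite_coeff q n k * (q ^ m - q ^ k / q) * poly (qroots_poly q k) x"
        by (simp add: h_def)
      then show ?thesis
        unfolding n qHermite_coeff_lower[OF q] by (simp only: g_def n mult.assoc)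
    qed
    then have "(\<Sum>k\<le>n. h k * (q ^ m - q ^ k / q)) =
        - (g / q) * (\<Sum>k\<le>m. qHermite_coeff q m k * poly (qroots_poly q k) x)"
      by (simp add: n qHermite_coeff_eq_0[OF q] sum_distrib_left)
    then show ?thesis
      using nz by (simp add: qHermite_altdef[OF q] C_def poly_sum)
  qed
  \<comment> \<open>the parameter is chosen such that \<open>1/\<psi>\<close> is \<open>q\<^sup>n\<^sup>-\<^sup>1\<close> plus a multiple of \<open>E/F\<close>:
      the first part turns the sum into \<open>H\<^sub>n\<^sub>-\<^sub>1\<close>, the second one into \<open>E/F\<close> times \<open>H\<^sub>n\<close>\<close>
  have inv_\<psi>: "inverse \<psi> = q ^ m - q ^ m / q * (g * E / F)"
  proof -
    have "q powi (int n - 2) = q ^ m / q"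
    proof -
      have "int n - 2 = int m - 1"
        using n by simp
      then show ?thesis
        using nz by (simp add: power_int_diff)
    qed
    moreover have "(1 - q) * qnum q (n - 1) = 1 - q ^ m"
      using nz n by (simp add: qnum_def)
    moreover have "inverse \<psi> = (1 - q) * (- (q powi (int n - 2) * qnum q n * E / F)) - (1 - q) * qnum q (n - 1) + 1"
      unfolding \<psi>_def psi_def vartheta_def E_def F_def by (simp add: right_diff_distrib)
    ultimately show ?thesis
      by (simp add: g(2)[symmetric] mult_ac)
  qed
  have \<psi>_pole: "\<psi> * inverse q * q ^ i \<noteq> 1" if "i < n" for i
  proof
    assume "\<psi> * inverse q * q ^ i = 1"
    then have "\<psi> = q / q ^ i"
      using nz by (simp add: field_simps)
    also have "\<dots> = q powi (1 - int i)"
      using nz by (simp add: power_int_diff)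
    finally show False
      using assms(11)[of i] that by (simp add: \<psi>_def)
  qed
  have "(1 - \<psi> * inverse q) * phi32 (q powi (- int n)) (inverse x) \<psi> 0 (\<psi> * inverse q) q (- (q * x)) =
      (\<Sum>k\<le>n. h k * (1 - \<psi> * (q ^ k / q)))" (is "?phi = _")
    unfolding h_def by (rule phi32_eq[OF q \<open>x \<noteq> 0\<close> \<psi>_pole])
  also have "\<dots> = (\<Sum>k\<le>n. \<psi> * (h k * (q ^ m - q ^ k / q) - h k * (q ^ m / q * (g * E / F))))"
  proof (rule sum.cong[OF refl])
    fix k
    have eq: "1 - \<psi> * (q ^ k / q) = \<psi> * (inverse \<psi> - q ^ k / q)"
      using nz by (simp add: algebra_simps)
    show "h k * (1 - \<psi> * (q ^ k / q)) =
        \<psi> * (h k * (q ^ m - q ^ k / q) - h k * (q ^ m / q * (g * E / F)))"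
      unfolding eq inv_\<psi> by (simp add: algebra_simps)
  qed
  also have "\<dots> = \<psi> * ((\<Sum>k\<le>n. h k * (q ^ m - q ^ k / q)) - (\<Sum>k\<le>n. h k) * (q ^ m / q * (g * E / F)))"
    by (simp only: sum_distrib_left[symmetric] sum_distrib_right[symmetric] sum_subtractf)
  also have "(\<Sum>k\<le>n. h k * (q ^ m - q ^ k / q)) = - g * poly (qHermite q m) x / (q * C)"
    using H_m nz by (simp add: field_simps)
  also have "(\<Sum>k\<le>n. h k) = poly (qHermite q n) x / (q ^ m * C)"
    using H_n nz by simp
  finally have phi: "?phi = - (\<psi> * g / (q * C * F)) * (E * poly (qHermite q n) x + F * poly (qHermite q m) x)"
    using nz by (simp add: divide_simps) (simp add: algebra_simps)
  have "int (n choose 2) - int n + 2 = int (Suc (m choose 2))"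
    using n by (simp add: choose_2_Suc)
  then have exponent: "q powi (int (n choose 2) - int n + 2) = q * C"
    by (simp only: power_int_of_nat power_Suc C_def)
  have "- (F * (1 - \<psi> * inverse q) * (q * C) / (qnum q n * \<psi> * (1 - q)))
      * phi32 (q powi (- int n)) (inverse x) \<psi> 0 (\<psi> * inverse q) q (- (q * x)) =
      - (F * (q * C) / (g * \<psi>)) * ?phi"
    unfolding g(2)[symmetric] by (simp add: mult_ac)
  also have "\<dots> = E * poly (qHermite q n) x + F * poly (qHermite q m) x"
    unfolding phi using nz g(1) by simp
  also have "\<dots> = poly (\<H> n) x"
    using sobolev_connection_formula[OF q assms(5,4,8), where m = m] unfolding E_def F_def n by simp
  finally show ?thesis
    unfolding exponent F_def \<psi>_def by simp
qed

end
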